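(* Let $n\ge 2$ and let $\mathfrak{L}$ be a finite-dimensional semisimple Leibniz algebra over a field $\mathbb{K}$ of characteristic zero. The ideals of the Leibniz $n$-algebra $\mathbf{U}_n(\mathfrak{L})$ are exactly the ideals of the Leibniz algebra $\mathfrak{L}$.
   Context: A Leibniz algebra is a vector space $\mathfrak{L}$ with a bilinear bracket satisfying $[[x,y],z]=[[x,z],y]+[x,[y,z]]$; ideals of $\mathfrak{L}$ are two-sided. The Leibniz kernel $\mathrm{Leib}(\mathfrak{L})$ is the two-sided ideal spanned by the squares $[x,x]$, $x\in\mathfrak{L}$. The radical $\mathrm{rad}(\mathfrak{L})$ is the maximal solvable ideal (solvable: $K^{(m)}=0$ for some $m$, where $K^{(0)}=K$, $K^{(j)}=[K^{(j-1)},K^{(j-1)}]$). $\mathfrak{L}$ is semisimple if $\mathrm{rad}(\mathfrak{L})=\mathrm{Leib}(\mathfrak{L})$. A Leibniz $n$-algebra is a vector space $L$ with an $n$-linear bracket satisfying $[[x_1,\ldots,x_n],y_1,\ldots,y_{n-1}]=\sum_{i=1}^{n}[x_1,\ldots,x_{i-1},[x_i,y_1,\ldots,y_{n-1}],x_{i+1},\ldots,x_n]$. For a Leibniz algebra $\mathfrak{L}$, $\mathbf{U}_n(\mathfrak{L})$ is the Leibniz $n$-algebra on the same vector space with bracket $[x_1,\dots,x_n]=[x_1,[\dots,[x_{n-2},[x_{n-1},x_n]]\dots]]$. An ideal of a Leibniz $n$-algebra $L$ is a subspace $I$ such that for every $1\le s\le n$ one has $[L,\dots,L,I,L,\dots,L]\subseteq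 I$ with $I$ in position $s$. *)

theory Defs
  imports Complex_Main
begin

text \<open>A Leibniz algebra lives on a whole type \<open>'a\<close>, with scalar multiplication \<open>scale\<close> over the
  field \<open>'k\<close>. The identity says that right multiplications are derivations.\<close>

locale leibniz_algebra = vector_space scale
  for scale :: "'k::field \<Rightarrow> 'a::ab_group_add \<Rightarrow> 'a" +
  fixes br :: "'a \<Rightarrow> 'a \<Rightarrow> 'a"
  assumes linear_left: "Vector_Spaces.linear scale scale (\<lambda>x. br x y)"
    and linear_right: "Vector_Spaces.linear scale scale (\<lambda>y. br x y)"
    and leibniz_identity: "br (br x y) z = br (br x z) y + br x (br y z)"

definition leibniz_ideal ::
    "('k::field \<Rightarrow> 'a::ab_group_add \<Rightarrow> 'a) \<Rightarrow> ('a \<Rightarrow> 'a \<Rightarrow> 'a) \<Rightarrow> 'a set \<Rightarrow> bool" where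
  "leibniz_ideal scale br I \<longleftrightarrow>
     module.subspace scale I \<and> (\<forall>x\<in>I. \<forall>y. br x y \<in> I \<and> br y x \<in> I)"

definition leibniz_kernel ::
    "('k::field \<Rightarrow> 'a::ab_group_add \<Rightarrow> 'a) \<Rightarrow> ('a \<Rightarrow> 'a \<Rightarrow> 'a) \<Rightarrow> 'a set" where
  "leibniz_kernel scale br = module.span scale {br x x |x. True}"

primrec derived_series ::
    "('k::field \<Rightarrow> 'a::ab_group_add \<Rightarrow> 'a) \<Rightarrow> ('a \<Rightarrow> 'a \<Rightarrow> 'a) \<Rightarrow> 'a set \<Rightarrow> nat \<Rightarrow> 'a set" where
  "derived_series scale br K 0 = K"
| "derived_series scale br K (Suc j) =
     module.span scale
       {br x y |x y. x \<in> derived_series scale br K j \<and> y \<in> derived_series scale br K j}"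

definition leibniz_solvable ::
    "('k::field \<Rightarrow> 'a::ab_group_add \<Rightarrow> 'a) \<Rightarrow> ('a \<Rightarrow> 'a \<Rightarrow> 'a) \<Rightarrow> 'a set \<Rightarrow> bool" where
  "leibniz_solvable scale br K \<longleftrightarrow> (\<exists>m. derived_series scale br K m = {0})"

text \<open>The greatest solvable ideal with respect to inclusion; it exists in finite dimension, see
  \<open>leibniz_rad_greatest\<close> below.\<close>

definition leibniz_rad ::
    "('k::field \<Rightarrow> 'a::ab_group_add \<Rightarrow> 'a) \<Rightarrow> ('a \<Rightarrow> 'a \<Rightarrow> 'a) \<Rightarrow> 'a set" where
  "leibniz_rad scale br =
     (GREATEST K. leibniz_ideal scale br K \<and> leibniz_solvable scale br K)"

definition leibniz_semisimple ::
    "('k::field \<Rightarrow> 'a::ab_group_add \<Rightarrow> 'a) \<Rightarrow> ('a \<Rightarrow> 'a \<Rightarrow> 'a) \<Rightarrow> bool" where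
  "leibniz_semisimple scale br \<longleftrightarrow> leibniz_rad scale br = leibniz_kernel scale br"

text \<open>An \<open>n\<close>-ary bracket is a function on lists, of which only the values on lists of length \<open>n\<close>
  matter. List positions count from \<open>0\<close>, so \<open>s < n\<close> stands for the position \<open>s + 1\<close>.\<close>

locale leibniz_n_algebra = vector_space scale
  for scale :: "'k::field \<Rightarrow> 'a::ab_group_add \<Rightarrow> 'a" +
  fixes n :: nat and w :: "'a list \<Rightarrow> 'a"
  assumes arity: "2 \<le> n"
    and n_linear: "length xs = n \<Longrightarrow> s < n \<Longrightarrow>
      Vector_Spaces.linear scale scale (\<lambda>x. w (xs[s := x]))"
    and n_leibniz_identity: "length xs = n \<Longrightarrow> length ys = n - 1 \<Longrightarrow>
      w (w xs # ys) = (\<Sum>i<n. w (xs[i := w (xs ! i # ys)]))"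

definition leibniz_n_ideal ::
    "('k::field \<Rightarrow> 'a::ab_group_add \<Rightarrow> 'a) \<Rightarrow> nat \<Rightarrow> ('a list \<Rightarrow> 'a) \<Rightarrow> 'a set \<Rightarrow> bool" where
  "leibniz_n_ideal scale n w I \<longleftrightarrow>
     module.subspace scale I \<and>
     (\<forall>s<n. \<forall>xs. length xs = n \<and> xs ! s \<in> I \<longrightarrow> w xs \<in> I)"

text \<open>The bracket of \<open>U\<^sub>n\<close>, for all \<open>n\<close> at once; the value on the empty list is irrelevant.\<close>

fun U_bracket :: "('a::zero \<Rightarrow> 'a \<Rightarrow> 'a) \<Rightarrow> 'a list \<Rightarrow> 'a" where
  "U_bracket br [] = 0"
| "U_bracket br [x] = x"
| "U_bracket br (x # y # ys) = br x (U_bracket br (y # ys))"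

context leibniz_algebra
begin

lemma br_add_left: "br (x + y) z = br x z + br y z"
  using linear_left[of z] by (simp add: Vector_Spaces.linear_iff)

lemma br_add_right: "br z (x + y) = br z x + br z y"
  using linear_right[of z] by (simp add: Vector_Spaces.linear_iff)

lemma br_scale_left: "br (scale c x) z = scale c (br x z)"
  using linear_left[of z] by (simp add: Vector_Spaces.linear_iff)

lemma br_scale_right: "br z (scale c x) = scale c (br z x)"
  using linear_right[of z] by (simp add: Vector_Spaces.linear_iff)

lemma br_zero_left: "br 0 z = 0"
  using br_add_left[of 0 0 z] by simp

lemma br_zero_right: "br z 0 = 0"
  using br_add_right[of z 0 0] by simp

lemma br_square_right: "br z (br x x) = 0"
  using leibniz_identity[of z x x] by simp

lemma br_square_left:
  "br (br x x) z = br (x + br x z) (x + br x z) - br x x - br (br x z) (br x z)"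
  using leibniz_identity[of x x z] by (simp add: br_add_left br_add_right)

lemma leibniz_kernel_ideal: "leibniz_ideal scale br (leibniz_kernel scale br)"
proof -
  let ?S = "{br x x |x. True}"
  have "br x y \<in> span ?S \<and> br y x \<in> span ?S" if "x \<in> span ?S" for x y
    using that
  proof (induction rule: span_induct_alt)
    case base
    show ?case by (simp add: br_zero_left br_zero_right span_zero)
  next
    case (step c s t)
    then obtain u where u: "s = br u u" by blast
    have "br s y \<in> span ?S"
      unfolding u br_square_left by (intro span_diff span_base) blast+
    moreover have "br y s \<in> span ?S"
      by (simp add: u br_square_right span_zero)
    ultimately show ?case
      using step.IH
      by (auto simp: br_add_left br_add_right br_scale_left br_scale_right
          intro: span_add span_scale)
  qed
  then show ?thesis
    by (simp add: leibniz_ideal_def leibniz_kernel_def)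
qed

lemma leibniz_idealD:
  assumes "leibniz_ideal scale br I"
  shows "subspace I" "x \<in> I \<Longrightarrow> br x y \<in> I" "x \<in> I \<Longrightarrow> br y x \<in> I"
  using assms by (auto simp: leibniz_ideal_def)

lemma derived_series_mono:
  "A \<subseteq> B \<Longrightarrow> derived_series scale br A m \<subseteq> derived_series scale br B m"
  by (induction m) (auto intro!: span_mono)

lemma derived_series_add:
  "derived_series scale br K (m + k) = derived_series scale br (derived_series scale br K m) k"
  by (induction k) auto

lemma subspace_derived_series:
  "subspace K \<Longrightarrow> subspace (derived_series scale br K m)"
  by (cases m) auto

lemma ideal_sum:
  assumes "leibniz_ideal scale br I" "leibniz_ideal scale br J"
  shows "leibniz_ideal scale br {x + y |x y. x \<in> I \<and> y \<in> J}"
proof -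
  have sub: "subspace I" "subspace J"
    using assms by (simp_all add: leibniz_ideal_def)
  show ?thesis
    unfolding leibniz_ideal_def
  proof (intro conjI ballI allI)
    show "subspace {x + y |x y. x \<in> I \<and> y \<in> J}"
      using sub by (rule subspace_sums)
  next
    fix u v
    assume "u \<in> {x + y |x y. x \<in> I \<and> y \<in> J}"
    then obtain x y where "u = x + y" "x \<in> I" "y \<in> J"
      by blast
    moreover from this have "br x v \<in> I" "br v x \<in> I" "br y v \<in> J" "br v y \<in> J"
      using assms by (simp_all add: leibniz_ideal_def)
    ultimately show "br u v \<in> {x + y |x y. x \<in> I \<and> y \<in> J}"
      and "br v u \<in> {x + y |x y. x \<in> I \<and> y \<in> J}"
      by (auto simp: br_add_left br_add_right)
  qed
qed

lemma derived_series_sum: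
  assumes I: "leibniz_ideal scale br I" and J: "leibniz_ideal scale br J"
  shows "derived_series scale br {x + y |x y. x \<in> I \<and> y \<in> J} m
    \<subseteq> {x + y |x y. x \<in> derived_series scale br I m \<and> y \<in> J}"
proof (induction m)
  case (Suc m)
  let ?D = "derived_series scale br"
  have sub: "subspace {x + y |x y. x \<in> ?D I (Suc m) \<and> y \<in> J}"
    using leibniz_idealD(1)[OF I] leibniz_idealD(1)[OF J]
    by (intro subspace_sums subspace_derived_series)
  have "br u v \<in> {x + y |x y. x \<in> ?D I (Suc m) \<and> y \<in> J}"
    if uv: "u \<in> ?D {x + y |x y. x \<in> I \<and> y \<in> J} m" "v \<in> ?D {x + y |x y. x \<in> I \<and> y \<in> J} m" for u v
  proof -
    obtain a b c d where *: "u = a + b" "v = c + d" "a \<in> ?D I m" "c \<in> ?D I m" "b \<in> J" "d \<in> J"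
      using uv Suc.IH by blast
    have "br u v = br a c + (br a d + br b v)"
      by (simp add: * br_add_left br_add_right algebra_simps)
    moreover have "br a c \<in> ?D I (Suc m)"
      using * by (auto intro: span_base)
    moreover have "br a d + br b v \<in> J"
      using * J by (intro subspace_add) (auto dest: leibniz_idealD)
    ultimately show ?thesis by blast
  qed
  then show ?case
    unfolding derived_series.simps(2)[of _ _ "{x + y |x y. x \<in> I \<and> y \<in> J}"]
    by (intro span_minimal sub) blast
qed simp

lemma solvable_sum:
  assumes I: "leibniz_ideal scale br I" "leibniz_solvable scale br I"
    and J: "leibniz_ideal scale br J" "leibniz_solvable scale br J"
  shows "leibniz_solvable scale br {x + y |x y. x \<in> I \<and> y \<in> J}"
proof -
  let ?D = "derived_series scale br"
  let ?K = "{x + y |x y. x \<in> I \<and> y \<in> J}"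
  obtain m k where m: "?D I m = {0}" and k: "?D J k = {0}"
    using I J by (auto simp: leibniz_solvable_def)
  have "?D ?K m \<subseteq> J"
    using derived_series_sum[OF I(1) J(1), of m] m by auto
  then have "?D ?K (m + k) \<subseteq> {0}"
    using derived_series_mono[of "?D ?K m" J k] k by (simp add: derived_series_add)
  moreover have "0 \<in> ?D ?K (m + k)"
    using I J by (intro subspace_0 subspace_derived_series subspace_sums leibniz_idealD)
  ultimately show ?thesis
    unfolding leibniz_solvable_def by blast
qed

text \<open>The radical is well defined.\<close>

lemma leibniz_rad_greatest:
  assumes fd: "finite_dimensional_vector_space scale Basis"
  shows "leibniz_ideal scale br (leibniz_rad scale br)"
    and "leibniz_solvable scale br (leibniz_rad scale br)"
    and "\<And>K. leibniz_ideal scale br K \<Longrightarrow> leibniz_solvable scale br K \<Longrightarrow>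
      K \<subseteq> leibniz_rad scale br"
proof -
  interpret finite_dimensional_vector_space scale Basis by (rule fd)
  let ?P = "\<lambda>K. leibniz_ideal scale br K \<and> leibniz_solvable scale br K"
  have "?P {0}"
    by (auto simp: leibniz_ideal_def leibniz_solvable_def br_zero_left br_zero_right
        intro!: exI[of _ 0])
  moreover have "\<forall>K. ?P K \<longrightarrow> dim K < Suc (dim UNIV)"
    using dim_subset_UNIV dimension_def dim_UNIV by (auto simp: less_Suc_eq_le)
  ultimately obtain R where R: "?P R" "\<And>K. ?P K \<Longrightarrow> dim K \<le> dim R"
    using ex_has_greatest_nat[of ?P "{0}" dim "Suc (dim UNIV)"] by (metis less_imp_le)
  have max: "K \<subseteq> R" if K: "?P K" for K
  proof -
    let ?S = "{x + y |x y. x \<in> R \<and> y \<in> K}"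
    have "?P ?S" using R(1) K ideal_sum solvable_sum by blast
    then have le: "dim ?S \<le> dim R" by (rule R(2))
    have sub: "subspace ?S" "subspace R" "subspace K"
      using \<open>?P ?S\<close> R(1) K leibniz_idealD(1) by blast+
    have "x \<in> ?S" if "x \<in> R" for x
      using that subspace_0[OF sub(3)] by (intro CollectI exI[of _ x] exI[of _ 0]) simp
    then have "R \<subseteq> ?S" by blast
    then have "R = ?S" using subspace_dim_equal[OF sub(2,1)] le by blast
    moreover have "x \<in> ?S" if "x \<in> K" for x
      using that subspace_0[OF sub(2)] by (intro CollectI exI[of _ 0] exI[of _ x]) simp
    ultimately show ?thesis by blast
  qed
  have "leibniz_rad scale br = R"
    unfolding leibniz_rad_def by (rule Greatest_equality) (use R(1) max in auto)
  then show "leibniz_ideal scale br (leibniz_rad scale br)"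
    "leibniz_solvable scale br (leibniz_rad scale br)"
    "\<And>K. leibniz_ideal scale br K \<Longrightarrow> leibniz_solvable scale br K \<Longrightarrow>
      K \<subseteq> leibniz_rad scale br"
    using R(1) max by auto
qed

lemma U_bracket_Cons: "xs \<noteq> [] \<Longrightarrow> U_bracket br (x # xs) = br x (U_bracket br xs)"
  by (cases xs) auto

lemma U_bracket_linear:
  "s < length xs \<Longrightarrow> Vector_Spaces.linear scale scale (\<lambda>x. U_bracket br (xs[s := x]))"
proof (induction xs arbitrary: s)
  case (Cons a xs)
  show ?case
  proof (cases "xs = []")
    case True
    then show ?thesis using Cons.prems linear_id by (simp add: id_def)
  next
    case False
    show ?thesis
    proof (cases s)
      case 0
      then show ?thesis using False by (simp add: U_bracket_Cons linear_left)
    next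
      case (Suc t)
      then have "Vector_Spaces.linear scale scale (\<lambda>x. U_bracket br (xs[t := x]))"
        using Cons by simp
      from Vector_Spaces.linear_compose[OF this linear_right[of a]] show ?thesis
        using Suc False by (simp add: U_bracket_Cons o_def)
    qed
  qed
qed simp

lemma U_bracket_derivation:
  "xs \<noteq> [] \<Longrightarrow>
    br (U_bracket br xs) z = (\<Sum>i<length xs. U_bracket br (xs[i := br (xs ! i) z]))"
proof (induction xs)
  case (Cons a xs)
  show ?case
  proof (cases "xs = []")
    case False
    interpret R: Vector_Spaces.linear scale scale "br a" by (rule linear_right)
    have "br (U_bracket br (a # xs)) z =
        br (br a z) (U_bracket br xs) + br a (br (U_bracket br xs) z)"
      using False leibniz_identity[of a "U_bracket br xs" z] by (simp only: U_bracket_Cons not_False_eq_True)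
    also have "br a (br (U_bracket br xs) z) =
        (\<Sum>i<length xs. br a (U_bracket br (xs[i := br (xs ! i) z])))"
      using Cons False by (simp add: R.sum)
    finally show ?thesis
      using False by (simp add: U_bracket_Cons sum.lessThan_Suc_shift del: sum.lessThan_Suc)
  qed simp
qed simp

lemma leibniz_n_algebra_U:
  assumes n: "2 \<le> n"
  shows "leibniz_n_algebra scale n (U_bracket br)"
proof (rule leibniz_n_algebra.intro[OF vector_space_axioms leibniz_n_algebra_axioms.intro])
  show "2 \<le> n" by (rule n)
next
  fix xs :: "'a list" and s
  assume "length xs = n" "s < n"
  then show "Vector_Spaces.linear scale scale (\<lambda>x. U_bracket br (xs[s := x]))"
    using U_bracket_linear[of s xs] by simp
next
  fix xs ys :: "'a list"
  assume len: "length xs = n" "length ys = n - 1"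
  have ne: "xs \<noteq> []" "ys \<noteq> []"
    using n len by auto
  have "U_bracket br (x # ys) = br x (U_bracket br ys)" for x
    using ne(2) by (rule U_bracket_Cons)
  then show "U_bracket br (U_bracket br xs # ys) =
      (\<Sum>i<n. U_bracket br (xs[i := U_bracket br (xs ! i # ys)]))"
    by (simp only: U_bracket_derivation[OF ne(1)] len(1))
qed

end

end

theory Submission
  imports Defs "HOL-Library.Function_Algebras" "HOL-Algebra.Algebraic_Closure_Type"
begin

text \<open>
  Write \<open>Leib\<close> for the Leibniz kernel of \<open>L\<close>. That an ideal of \<open>L\<close> is an ideal of \<open>U\<^sub>n(L)\<close> is immediate
  from the nested form of the bracket. The converse rests on one structural fact,
  \<open>ideal_generated_by_products\<close>: if \<open>L\<close> is semisimple, every ideal \<open>J \<supseteq> Leib\<close> is spanned by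
  \<open>Leib\<close> and the products \<open>[j, y]\<close> with \<open>j \<in> J\<close>. As \<open>[x, Leib] = 0\<close>, a product \<open>[x, y]\<close> depends on \<open>y\<close>
  only modulo \<open>Leib\<close>. For \<open>J = L\<close> the fact therefore lets one replace \<open>y\<close> by a combination of
  nested brackets of any prescribed length, so that for an ideal \<open>I\<close> of \<open>U\<^sub>n(L)\<close> the product \<open>[i, y]\<close>
  becomes a combination of \<open>n\<close>-fold brackets with \<open>i\<close> in the first place; thus \<open>[I, L] \<subseteq> I\<close>. Then
  \<open>I + Leib\<close> is an ideal of \<open>L\<close>, and for \<open>J = I + Leib\<close> the fact lets one replace \<open>i\<close> by nested brackets
  that start with an element of \<open>I\<close>; thus \<open>[y, i]\<close> is a combination of \<open>n\<close>-fold brackets with an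
  element of \<open>I\<close> in the second place.

  The structural fact is proved with the trace form \<open>(a, b) \<mapsto> tr (R\<^sub>a R\<^sub>b)\<close>, where \<open>R\<^sub>a\<close> is right
  multiplication by \<open>a\<close>. It is symmetric and invariant, and \<open>Leib\<close> lies in its radical. Let \<open>D\<close> be the
  span of \<open>[J, L]\<close> and \<open>Leib\<close>. On \<open>D \<inter> D\<^sup>\<bottom>\<close> the form vanishes, so this ideal is solvable by Cartan's
  criterion and hence contained in \<open>Leib\<close>, the radical. Consequently every \<open>x \<in> J\<close> has an orthogonal
  projection \<open>d \<in> D\<close>. The difference \<open>x - d\<close> lies in \<open>J \<inter> D\<^sup>\<bottom>\<close>, an ideal whose products are in
  \<open>D \<inter> D\<^sup>\<bottom> \<subseteq> Leib\<close>; so it is solvable too, and \<open>x - d \<in> Leib \<subseteq> D\<close>.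

  Cartan's criterion (\<open>cartan_solvable\<close>) is linear algebra over the algebraic closure. If the trace form
  vanishes on a subalgebra \<open>A\<close> and \<open>x \<in> [A, A]\<close>, write the \<open>R\<^sub>a\<close> as matrices. In a
  basis of generalised eigenvectors of \<open>R\<^sub>x\<close>, with eigenvalues \<open>\<lambda>\<close>, take the diagonal operator \<open>E\<close> with
  entries \<open>f \<lambda>\<close> for a \<open>\<rat>\<close>-linear \<open>f\<close> with rational values. Every space of matrices that is invariant
  under \<open>[R\<^sub>x, _]\<close> is invariant under \<open>[E, _]\<close>; applied to the annihilator of \<open>R\<^sub>A\<close> under the trace this
  gives \<open>0 = tr (R\<^sub>x E) = \<Sum> \<lambda> f \<lambda>\<close>. Applying \<open>f\<close> yields \<open>\<Sum> (f \<lambda>)\<^sup>2 = 0\<close>, so all \<open>f \<lambda>\<close> and hence all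
  \<open>\<lambda>\<close> vanish: \<open>R\<^sub>x\<close> is nilpotent. Engel's theorem then shows that the derived series of \<open>A\<close> decreases
  strictly until it reaches \<open>0\<close>.
\<close>

section \<open>Generalised eigencomponents in invariant subspaces\<close>

locale linear_operator = vector_space scale
  for scale :: "'f::field \<Rightarrow> 'v::ab_group_add \<Rightarrow> 'v" (infixr "*s" 75) +
  fixes T :: "'v \<Rightarrow> 'v"
  assumes T_add: "T (u + v) = T u + T v"
    and T_scale: "T (c *s v) = c *s T v"
begin

lemma T_zero [simp]: "T 0 = 0"
  using T_add[of 0 0] by simp

lemma T_diff: "T (u - v) = T u - T v"
  using T_add[of "u - v" v] by simp

definition shift :: "'f \<Rightarrow> 'v \<Rightarrow> 'v" where
  "shift l x = T x - l *s x"

lemma shift_add: "shift l (x + y) = shift l x + shift l y"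
  by (simp add: shift_def T_add scale_right_distrib)

lemma shift_commute: "shift l (shift m x) = shift m (shift l x)"
  by (simp add: shift_def T_diff T_scale scale_right_diff_distrib mult.commute)

lemma shift_pow_commute: "(shift l ^^ i) ((shift m ^^ j) x) = (shift m ^^ j) ((shift l ^^ i) x)"
proof -
  have "(shift l ^^ i) (shift m x) = shift m ((shift l ^^ i) x)" for x
    by (induction i) (simp_all add: shift_commute[of l m])
  then show ?thesis by (induction j) simp_all
qed

lemma shift_pow_sum: "(shift l ^^ j) (sum u F) = (\<Sum>a\<in>F. (shift l ^^ j) (u a))"
proof -
  have add: "(shift l ^^ j) (x + y) = (shift l ^^ j) x + (shift l ^^ j) y" for x y
    by (induction j) (simp_all add: shift_add)
  show ?thesis
    using add[of 0 0] by (induction F rule: infinite_finite_induct) (simp_all add: add)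
qed

lemma shift_pow_mem:
  assumes W: "subspace W" "\<And>x. x \<in> W \<Longrightarrow> T x \<in> W" and x: "x \<in> W"
  shows "(shift l ^^ j) x \<in> W"
proof (induction j)
  case (Suc j)
  show ?case
    using subspace_diff[OF W(1) W(2)[OF Suc.IH] subspace_scale[OF W(1) Suc.IH, of l]]
    by (simp add: shift_def)
qed (simp add: x)

text \<open>If \<open>m \<noteq> l\<close>, the operator \<open>T - m\<close> is injective modulo \<open>W\<close> on the generalised eigenvectors of \<open>l\<close>
  modulo \<open>W\<close>: by induction on \<open>k\<close> also \<open>(T - l) u \<in> W\<close>, and \<open>(T - m) u\<close> and \<open>(T - l) u\<close> differ by a
  non-zero multiple of \<open>u\<close>.\<close>
lemma shift_cancel:
  assumes W: "subspace W" "\<And>x. x \<in> W \<Longrightarrow> T x \<in> W"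
    and ne: "m \<noteq> l"
    and "(shift l ^^ k) u \<in> W" "shift m u \<in> W"
  shows "u \<in> W"
  using assms(4,5)
proof (induction k arbitrary: u)
  case (Suc k)
  have "shift m (shift l u) \<in> W"
    using shift_pow_mem[OF W Suc.prems(2), where l = l and j = 1] by (simp add: shift_commute)
  moreover have "(shift l ^^ k) (shift l u) \<in> W"
    using Suc.prems(1) by (simp add: funpow_swap1)
  ultimately have "shift l u \<in> W" by (rule Suc.IH[rotated])
  note subspace_diff[OF W(1) Suc.prems(2) this]
  also have "shift m u - shift l u = (l - m) *s u"
    by (simp add: shift_def scale_left_diff_distrib)
  finally have "inverse (l - m) *s ((l - m) *s u) \<in> W" by (rule subspace_scale[OF W(1)])
  then show ?case using ne by simp
qed simp

lemma shift_power_cancel: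
  assumes W: "subspace W" "\<And>x. x \<in> W \<Longrightarrow> T x \<in> W"
    and ne: "m \<noteq> l"
    and "(shift l ^^ k) u \<in> W" "(shift m ^^ j) u \<in> W"
  shows "u \<in> W"
  using assms(4,5)
proof (induction j arbitrary: u)
  case (Suc j)
  have "(shift l ^^ k) (shift m u) \<in> W"
    using shift_pow_mem[OF W Suc.prems(1), where l = m and j = 1]
      shift_pow_commute[where l = l and i = k and m = m and j = 1 and x = u] by simp
  moreover have "(shift m ^^ j) (shift m u) \<in> W"
    using Suc.prems(2) by (simp add: funpow_swap1)
  ultimately have "shift m u \<in> W" by (rule Suc.IH)
  then show ?case using shift_cancel[OF W ne Suc.prems(1)] by blast
qed simp

text \<open>Generalised eigencomponents of a vector of an invariant subspace lie in that subspace. It suffices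
  that the components are generalised eigenvectors modulo \<open>W\<close>. The proof removes one eigenvalue \<open>m\<close> by
  applying \<open>(T - m)\<^sup>k\<close> to the sum, and cancels this factor again on the other components.\<close>
lemma component_in_invariant_subspace:
  assumes W: "subspace W" "\<And>x. x \<in> W \<Longrightarrow> T x \<in> W"
    and "finite F" "\<And>l. l \<in> F \<Longrightarrow> (shift l ^^ k) (u l) \<in> W" "sum u F \<in> W" "l \<in> F"
  shows "u l \<in> W"
  using assms(3-)
proof (induction F arbitrary: u l rule: finite_induct)
  case (insert m F)
  have "(shift m ^^ k) (sum u (insert m F)) =
      (shift m ^^ k) (u m) + (\<Sum>l\<in>F. (shift m ^^ k) (u l))"
    unfolding shift_pow_sum using insert.hyps by simp
  moreover have "(shift m ^^ k) (sum u (insert m F)) - (shift m ^^ k) (u m) \<in> W"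
    using shift_pow_mem[OF W insert.prems(2)] insert.prems(1)[of m] by (simp add: subspace_diff W(1))
  ultimately have sum_in: "(\<Sum>l\<in>F. (shift m ^^ k) (u l)) \<in> W" by simp
  have in_F: "u a \<in> W" if "a \<in> F" for a
  proof -
    have "(shift m ^^ k) (u a) \<in> W"
    proof (rule insert.IH[OF _ sum_in that])
      fix b assume "b \<in> F"
      then show "(shift b ^^ k) ((shift m ^^ k) (u b)) \<in> W"
        unfolding shift_pow_commute[where l = b] using shift_pow_mem[OF W insert.prems(1)[of b]] by simp
    qed
    moreover have "m \<noteq> a" using that insert.hyps by blast
    ultimately show ?thesis
      using shift_power_cancel[OF W, of m a k "u a" k] insert.prems(1)[of a] that by simp
  qed
  show ?case
  proof (cases "l = m")
    case True
    have "sum u F \<in> W" by (rule subspace_sum[OF W(1) in_F])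
    from subspace_diff[OF W(1) insert.prems(2) this] show ?thesis
      using True insert.hyps by simp
  next
    case False
    then show ?thesis using in_F insert.prems(3) by blast
  qed
qed simp

end

section \<open>Block-triangular bases over an algebraically closed field\<close>

locale alg_closed_operator = linear_operator scale T
  for scale :: "'f::alg_closed_field \<Rightarrow> 'v::ab_group_add \<Rightarrow> 'v" (infixr "*s" 75)
    and T :: "'v \<Rightarrow> 'v"
begin

text \<open>The Horner form of \<open>p(T) v\<close>.\<close>
definition poly_apply :: "'f poly \<Rightarrow> 'v \<Rightarrow> 'v" where
  "poly_apply p v = fold_coeffs (\<lambda>a w. a *s v + T w) p 0"

lemma poly_apply_0 [simp]: "poly_apply 0 v = 0"
  by (simp add: poly_apply_def)

lemma poly_apply_pCons [simp]: "poly_apply (pCons a p) v = a *s v + T (poly_apply p v)"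
  by (cases "p = 0"; cases "a = 0") (simp_all add: poly_apply_def)

lemma poly_apply_add: "poly_apply (p + q) v = poly_apply p v + poly_apply q v"
  by (induction p q rule: poly_induct2) (simp_all add: scale_left_distrib T_add algebra_simps)

lemma poly_apply_smult: "poly_apply (Polynomial.smult c p) v = c *s poly_apply p v"
  by (induction p) (simp_all add: T_scale scale_right_distrib)

lemma poly_apply_monom: "poly_apply (Polynomial.monom c n) v = c *s (T ^^ n) v"
  by (induction n) (simp_all add: monom_0 monom_Suc T_scale)

lemma poly_apply_linear_factor: "poly_apply ([:- ev, 1:] * q) v = T (poly_apply q v) - ev *s poly_apply q v"
proof -
  have "[:- ev, 1:] * q = Polynomial.smult (- ev) q + pCons 0 q" by simp
  then show ?thesis by (simp only: poly_apply_add poly_apply_smult poly_apply_pCons) simp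
qed

lemma poly_apply_invariant:
  assumes "subspace U" "\<And>u. u \<in> U \<Longrightarrow> T u \<in> U" "v \<in> U"
  shows "poly_apply p v \<in> U"
  by (induction p) (use assms in \<open>auto intro: subspace_add subspace_scale subspace_0\<close>)

text \<open>The iterates \<open>T\<^sup>j u\<close> cannot all be independent in a space of finite dimension.\<close>
lemma annihilating_poly_exists:
  assumes E: "finite E" and inv: "\<And>u. u \<in> span E \<Longrightarrow> T u \<in> span E" and u: "u \<in> span E"
  shows "\<exists>p. p \<noteq> 0 \<and> poly_apply p u = 0"
proof -
  let ?S = "\<lambda>k. (\<lambda>j. (T ^^ j) u) ` {..<k}"
  have pow: "(T ^^ k) u \<in> span E" for k
    by (induction k) (simp_all add: u inv)
  have "\<exists>k. (T ^^ k) u \<in> span (?S k)"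
  proof (rule ccontr)
    assume *: "\<nexists>k. (T ^^ k) u \<in> span (?S k)"
    have "independent (?S k) \<and> card (?S k) = k" for k
    proof (induction k)
      case (Suc k)
      have nin: "(T ^^ k) u \<notin> span (?S k)" using * by simp
      then have "(T ^^ k) u \<notin> ?S k" using span_base[of "(T ^^ k) u" "?S k"] by metis
      then show ?case
        using Suc independent_insertI[OF nin] by (simp add: lessThan_Suc)
    qed (simp add: independent_empty)
    moreover have "?S k \<subseteq> span E" for k using pow by auto
    ultimately have "card (?S k) = k" "card (?S k) \<le> card E" for k
      using independent_span_bound[OF E, of "?S k"] by simp_all
    from this[of "Suc (card E)"] show False by simp
  qed
  then obtain k where k: "(T ^^ k) u \<in> span (?S k)" by blast
  have "\<exists>p. (\<forall>i\<ge>k. Polynomial.coeff p i = 0) \<and> x = poly_apply p u" if "x \<in> span (?S k)" for x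
    using that
  proof (induction rule: span_induct_alt)
    case base
    show ?case by (intro exI[of _ 0]) simp
  next
    case (step c x y)
    then obtain p j where "\<forall>i\<ge>k. Polynomial.coeff p i = 0" "y = poly_apply p u" "j < k" "x = (T ^^ j) u" by blast
    then show ?case
      by (intro exI[of _ "Polynomial.monom c j + p"]) (simp add: poly_apply_add poly_apply_monom)
  qed
  from this[OF span_neg[OF k]] obtain p where
    p: "\<And>i. i \<ge> k \<Longrightarrow> Polynomial.coeff p i = 0" "- (T ^^ k) u = poly_apply p u"
    by blast
  let ?q = "Polynomial.monom 1 k + p"
  have "Polynomial.coeff ?q k = 1" using p(1)[of k] by simp
  then have "?q \<noteq> 0" by (metis coeff_0 zero_neq_one)
  moreover have "poly_apply ?q u = 0" by (simp add: poly_apply_add poly_apply_monom flip: p(2))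
  ultimately show ?thesis by blast
qed

text \<open>The operator induced on the quotient by \<open>U\<close> has an eigenvector: for a polynomial \<open>p\<close> of least degree
  with \<open>p(T) u \<in> U\<close>, split off a linear factor, \<open>p = (t - \<lambda>) q\<close>, and take \<open>q(T) u\<close>.\<close>
lemma eigenvector_modulo_invariant:
  assumes E: "finite E" and inv: "\<And>u. u \<in> span E \<Longrightarrow> T u \<in> span E"
    and U: "subspace U" "\<And>u. u \<in> U \<Longrightarrow> T u \<in> U" and ne: "\<not> span E \<subseteq> U"
  obtains v ev where "v \<in> span E" "v \<notin> U" "T v - ev *s v \<in> U"
proof -
  obtain u where u: "u \<in> span E" "u \<notin> U" using ne by blast
  have "\<exists>p. p \<noteq> 0 \<and> poly_apply p u \<in> U"
    using annihilating_poly_exists[OF E inv u(1)] subspace_0[OF U(1)] by metis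
  then obtain p where p: "p \<noteq> 0" "poly_apply p u \<in> U"
    and min: "\<And>q. q \<noteq> 0 \<Longrightarrow> poly_apply q u \<in> U \<Longrightarrow> degree p \<le> degree q"
    using ex_has_least_nat[of "\<lambda>p. p \<noteq> 0 \<and> poly_apply p u \<in> U" _ degree] by metis
  have "degree p > 0"
  proof (rule ccontr)
    assume "\<not> degree p > 0"
    then obtain a where a: "p = [:a:]" using degree_eq_zeroE by blast
    with p have "a \<noteq> 0" "a *s u \<in> U" by simp_all
    then have "inverse a *s (a *s u) \<in> U" by (metis subspace_scale[OF U(1)])
    then show False using \<open>a \<noteq> 0\<close> u by simp
  qed
  then obtain ev where "poly p ev = 0" using alg_closed_imp_poly_has_root by blast
  then obtain q where q: "p = [:- ev, 1:] * q" using poly_eq_0_iff_dvd[of p ev] by blast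
  have "q \<noteq> 0" using p q by auto
  moreover from this have "degree p = Suc (degree q)"
    unfolding q by (subst degree_mult_eq) auto
  ultimately have "poly_apply q u \<notin> U" using min[of q] by auto
  moreover have "poly_apply q u \<in> span E" by (rule poly_apply_invariant) (use inv u in auto)
  moreover have "T (poly_apply q u) - ev *s poly_apply q u \<in> U"
    using p(2) unfolding q poly_apply_linear_factor .
  ultimately show ?thesis using that by blast
qed

text \<open>The matrix of \<open>T\<close> in such a basis is triangular with respect to the rank \<open>r\<close>, with the eigenvalues
  \<open>ev\<close> on the diagonal, and it has no entries that link different eigenvalues: a coarse version of the
  Jordan normal form.\<close>
definition block_triangular_basis :: "'v set \<Rightarrow> ('v \<Rightarrow> 'f) \<Rightarrow> ('v \<Rightarrow> nat) \<Rightarrow> bool" where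
  "block_triangular_basis C ev r \<longleftrightarrow> finite C \<and> independent C \<and>
     (\<forall>c\<in>C. T c - ev c *s c \<in> span {c'\<in>C. ev c' = ev c \<and> r c' < r c})"

lemma block_triangular_basis_invariant:
  assumes "block_triangular_basis C ev r" "u \<in> span C"
  shows "T u \<in> span C"
  using assms(2)
proof (induction rule: span_induct_alt)
  case (step c x y)
  have "T x - ev x *s x \<in> span C"
    using assms(1) step(1) span_mono[of "{c'\<in>C. ev c' = ev x \<and> r c' < r x}" C]
    by (auto simp: block_triangular_basis_def)
  moreover have "ev x *s x \<in> span C" by (rule span_scale[OF span_base[OF step(1)]])
  ultimately have "(T x - ev x *s x) + ev x *s x \<in> span C" by (rule span_add)
  then show ?case using step by (simp add: T_add T_scale span_add span_scale)
qed (simp add: span_zero)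

text \<open>On the span of the basis vectors with eigenvalue different from \<open>l\<close>, the operator \<open>T - l\<close> is triangular
  with non-zero diagonal, hence onto.\<close>
lemma shift_surj_on_other_eigenvalues:
  assumes J: "block_triangular_basis C ev r"
    and y: "y \<in> span {c\<in>C. ev c \<noteq> l}"
  shows "\<exists>w\<in>span {c\<in>C. ev c \<noteq> l}. y = T w - l *s w"
proof -
  let ?C = "{c\<in>C. ev c \<noteq> l}"
  let ?I = "(\<lambda>w. T w - l *s w) ` span ?C"
  have sub: "subspace ?I"
  proof (rule subspaceI)
    show "0 \<in> ?I" by (rule image_eqI[of _ _ 0]) (simp_all add: span_zero)
  next
    fix x y assume "x \<in> ?I" "y \<in> ?I"
    then obtain v w where "v \<in> span ?C" "w \<in> span ?C" "x = T v - l *s v" "y = T w - l *s w" by blast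
    then show "x + y \<in> ?I"
      by (intro image_eqI[of _ _ "v + w"]) (simp_all add: span_add T_add scale_right_distrib)
  next
    fix c x assume "x \<in> ?I"
    then obtain v where "v \<in> span ?C" "x = T v - l *s v" by blast
    then show "c *s x \<in> ?I"
      by (intro image_eqI[of _ _ "c *s v"])
        (simp_all add: span_scale T_scale scale_right_diff_distrib mult.commute)
  qed
  have "c \<in> ?I" if "c \<in> ?C" for c
    using that
  proof (induction "r c" arbitrary: c rule: less_induct)
    case less
    have "{c'\<in>C. ev c' = ev c \<and> r c' < r c} \<subseteq> ?I" using less by auto
    moreover have "T c - ev c *s c \<in> span {c'\<in>C. ev c' = ev c \<and> r c' < r c}"
      using J less by (auto simp: block_triangular_basis_def)
    ultimately have 1: "T c - ev c *s c \<in> ?I" using span_minimal[OF _ sub] by blast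
    have 2: "T c - l *s c \<in> ?I" using less(2) by (intro imageI span_base)
    note subspace_diff[OF sub 2 1]
    also have "(T c - l *s c) - (T c - ev c *s c) = (ev c - l) *s c"
      by (simp add: scale_left_diff_distrib)
    finally have "inverse (ev c - l) *s ((ev c - l) *s c) \<in> ?I"
      by (rule subspace_scale[OF sub])
    also have "inverse (ev c - l) *s ((ev c - l) *s c) = c" using less(2) by simp
    finally show "c \<in> ?I" .
  qed
  then have "span ?C \<subseteq> ?I" by (intro span_minimal sub) blast
  then show ?thesis using y by blast
qed

text \<open>Take an eigenvector \<open>v\<close> modulo the span of \<open>C\<close>, with eigenvalue \<open>l\<close>. The part of \<open>(T - l) v\<close> that
  belongs to other eigenvalues is \<open>(T - l) w\<close> for some \<open>w\<close> in the span of \<open>C\<close>, so \<open>v - w\<close> can be added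
  as a vector of the largest rank.\<close>
lemma block_triangular_basis_extend:
  assumes E: "finite E" and inv: "\<And>u. u \<in> span E \<Longrightarrow> T u \<in> span E"
    and J: "block_triangular_basis C ev r" and C: "C \<subseteq> span E" and ne: "\<not> span E \<subseteq> span C"
  shows "\<exists>v ev' r'. v \<in> span E \<and> v \<notin> C \<and> block_triangular_basis (insert v C) ev' r'"
proof -
  obtain v l where v: "v \<in> span E" "v \<notin> span C" "T v - l *s v \<in> span C"
    using eigenvector_modulo_invariant[OF E inv _ _ ne] block_triangular_basis_invariant[OF J] by blast
  let ?C1 = "{c\<in>C. ev c = l}" and ?C2 = "{c\<in>C. ev c \<noteq> l}"
  have "C = ?C1 \<union> ?C2" by blast
  then have "T v - l *s v \<in> {x + y |x y. x \<in> span ?C1 \<and> y \<in> span ?C2}"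
    using v(3) span_Un by metis
  then obtain y1 y2 where y: "T v - l *s v = y1 + y2" "y1 \<in> span ?C1" "y2 \<in> span ?C2"
    by blast
  obtain w where w: "w \<in> span ?C2" "y2 = T w - l *s w"
    using shift_surj_on_other_eigenvalues[OF J y(3)] by blast
  have w_in: "w \<in> span C" using w span_mono[of ?C2 C] by blast
  let ?v = "v - w"
  have "T ?v - l *s ?v = y1"
    using y(1) w(2) by (simp add: T_diff scale_right_diff_distrib algebra_simps)
  with y have 1: "T ?v - l *s ?v \<in> span ?C1" by simp
  have nin: "?v \<notin> span C"
    using v(2) w_in span_add[of ?v C w] by auto
  then have nC: "?v \<notin> C" using span_base by blast
  have fin: "finite C" using J by (simp add: block_triangular_basis_def)
  \<comment> \<open>the new vector gets the eigenvalue \<open>l\<close> and a rank above all ranks in use\<close>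
  define ev' where "ev' = ev(?v := l)"
  define r' where "r' = r(?v := Suc (Max (r ` C)))"
  have old: "ev' c = ev c" "r' c = r c" if "c \<in> C" for c
    using that nC by (auto simp: ev'_def r'_def)
  have new: "ev' ?v = l" "r' ?v = Suc (Max (r ` C))" by (auto simp: ev'_def r'_def)
  have "r c \<le> Max (r ` C)" if "c \<in> C" for c using that fin by auto
  then have lt: "r' c < r' ?v" if "c \<in> C" for c using that old new by (simp add: le_imp_less_Suc)
  have "T c - ev' c *s c \<in> span {c'\<in>insert ?v C. ev' c' = ev' c \<and> r' c' < r' c}"
    if "c \<in> insert ?v C" for c
  proof (cases "c \<in> C")
    case True
    then have "T c - ev c *s c \<in> span {c'\<in>C. ev c' = ev c \<and> r c' < r c}"
      using J by (auto simp: block_triangular_basis_def)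
    moreover have "{c'\<in>C. ev c' = ev c \<and> r c' < r c} \<subseteq> {c'\<in>insert ?v C. ev' c' = ev' c \<and> r' c' < r' c}"
      using True old by auto
    ultimately show ?thesis using span_mono True old by auto
  next
    case False
    then have c: "c = ?v" using that by blast
    have "?C1 \<subseteq> {c'\<in>insert ?v C. ev' c' = ev' ?v \<and> r' c' < r' ?v}"
      using old new lt by auto
    then show ?thesis using 1 span_mono unfolding c new by blast
  qed
  moreover have "independent (insert ?v C)"
    using J nin by (simp add: block_triangular_basis_def independent_insertI)
  ultimately have "block_triangular_basis (insert ?v C) ev' r'"
    using fin by (simp add: block_triangular_basis_def)
  moreover have "?v \<in> span E"
    using v(1) w_in C span_minimal[of C "span E"] by (intro span_diff) auto
  ultimately show ?thesis using nC by blast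
qed

lemma block_triangular_basis_exists:
  assumes E: "finite E" and inv: "\<And>u. u \<in> span E \<Longrightarrow> T u \<in> span E"
  obtains C ev r where "block_triangular_basis C ev r" "span C = span E"
proof -
  let ?P = "\<lambda>C. C \<subseteq> span E \<and> (\<exists>ev r. block_triangular_basis C ev r)"
  have "?P {}" by (simp add: block_triangular_basis_def independent_empty)
  moreover have "\<forall>C. ?P C \<longrightarrow> card C < Suc (card E)"
  proof (intro allI impI)
    fix C assume "?P C"
    then have "independent C" "C \<subseteq> span E" by (auto simp: block_triangular_basis_def)
    then show "card C < Suc (card E)" using independent_span_bound[OF E, of C] by simp
  qed
  ultimately have "\<exists>C. ?P C \<and> (\<forall>C'. ?P C' \<longrightarrow> card C' \<le> card C)"
    by (rule Lattices_Big.ex_has_greatest_nat)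
  then obtain C where C: "?P C" and max: "\<And>C'. ?P C' \<Longrightarrow> card C' \<le> card C"
    by blast
  then obtain ev r where J: "block_triangular_basis C ev r" by blast
  have "span E \<subseteq> span C"
  proof (rule ccontr)
    assume "\<not> ?thesis"
    then obtain v ev' r' where v: "v \<in> span E" "v \<notin> C" "block_triangular_basis (insert v C) ev' r'"
      using block_triangular_basis_extend[OF E inv J] C by blast
    then have "card (insert v C) \<le> card C" using C by (intro max) auto
    then show False using v J by (simp add: block_triangular_basis_def)
  qed
  moreover have "span C \<subseteq> span E" using C by (intro span_minimal) auto
  ultimately show ?thesis using that[OF J] by blast
qed

lemma nilpotent_if_eigenvalues_0:
  assumes J: "block_triangular_basis C ev r" and ev: "\<And>c. c \<in> C \<Longrightarrow> ev c = 0"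
  shows "\<exists>m. \<forall>v\<in>span C. (T ^^ m) v = 0"
proof -
  have fin: "finite C" using J by (simp add: block_triangular_basis_def)
  have pow: "(T ^^ m) (u + v) = (T ^^ m) u + (T ^^ m) v" "(T ^^ m) (c *s v) = c *s (T ^^ m) v"
    "(T ^^ m) 0 = 0" for m u v c
    by (induction m) (simp_all add: T_add T_scale)
  have kernel: "(T ^^ m) v = 0" if "v \<in> span S" "\<And>s. s \<in> S \<Longrightarrow> (T ^^ m) s = 0" for m v S
    using that(1) by (induction rule: span_induct_alt) (simp_all add: pow that(2))
  have "(T ^^ m) c = 0" if "c \<in> C" "r c < m" for c m
    using that
  proof (induction m arbitrary: c)
    case (Suc m)
    have "T c \<in> span {c'\<in>C. ev c' = ev c \<and> r c' < r c}"
      using J Suc.prems(1) ev[of c] by (auto simp: block_triangular_basis_def)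
    then have "(T ^^ m) (T c) = 0" by (rule kernel) (use Suc in auto)
    then show ?case by (simp add: funpow_swap1)
  qed simp
  moreover have "r c < Suc (Max (r ` C))" if "c \<in> C" for c
    using that fin by (simp add: le_imp_less_Suc)
  ultimately show ?thesis
    using kernel by (intro exI[of _ "Suc (Max (r ` C))"]) blast
qed

end

section \<open>Matrices over finite index sets\<close>

text \<open>A matrix is a function of two indices; only its entries in a finite set of indices matter, and the
  set over which a product sums is a parameter. So a set of basis vectors can serve as index set.\<close>
definition mprod :: "'k set \<Rightarrow> ('i \<Rightarrow> 'k \<Rightarrow> 'f::comm_ring) \<Rightarrow> ('k \<Rightarrow> 'j \<Rightarrow> 'f) \<Rightarrow> 'i \<Rightarrow> 'j \<Rightarrow> 'f" where
  "mprod K A B = (\<lambda>i j. \<Sum>k\<in>K. A i k * B k j)"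

definition mtrace :: "'i set \<Rightarrow> ('i \<Rightarrow> 'i \<Rightarrow> 'f::comm_ring) \<Rightarrow> 'f" where
  "mtrace K A = (\<Sum>i\<in>K. A i i)"

definition mscale :: "'f::comm_ring \<Rightarrow> ('i \<Rightarrow> 'j \<Rightarrow> 'f) \<Rightarrow> 'i \<Rightarrow> 'j \<Rightarrow> 'f" where
  "mscale c A = (\<lambda>i j. c * A i j)"

definition commutator :: "'i set \<Rightarrow> ('i \<Rightarrow> 'i \<Rightarrow> 'f::comm_ring) \<Rightarrow> ('i \<Rightarrow> 'i \<Rightarrow> 'f) \<Rightarrow> 'i \<Rightarrow> 'i \<Rightarrow> 'f" where
  "commutator K A B = mprod K A B - mprod K B A"

lemma mprod_assoc: "mprod L (mprod K A B) C = mprod K A (mprod L B C)"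
proof (intro ext)
  fix i j
  have "mprod L (mprod K A B) C i j = (\<Sum>l\<in>L. \<Sum>k\<in>K. A i k * B k l * C l j)"
    by (simp add: mprod_def sum_distrib_right)
  also have "\<dots> = (\<Sum>k\<in>K. \<Sum>l\<in>L. A i k * B k l * C l j)" by (rule sum.swap)
  also have "\<dots> = mprod K A (mprod L B C) i j"
    by (simp add: mprod_def sum_distrib_left mult.assoc)
  finally show "mprod L (mprod K A B) C i j = mprod K A (mprod L B C) i j" .
qed

lemma mprod_add: "mprod K (A + B) C = mprod K A C + mprod K B C" "mprod K D (E + F) = mprod K D E + mprod K D F"
  by (auto simp: mprod_def fun_eq_iff algebra_simps sum.distrib)

lemma mprod_diff: "mprod K (A - B) C = mprod K A C - mprod K B C" "mprod K D (E - F) = mprod K D E - mprod K D F"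
  by (auto simp: mprod_def fun_eq_iff algebra_simps sum_subtractf)

lemma mprod_mscale: "mprod K (mscale c A) B = mscale c (mprod K A B)" "mprod K A (mscale c B) = mscale c (mprod K A B)"
  by (auto simp: mprod_def mscale_def fun_eq_iff algebra_simps sum_distrib_left)

lemma mprod_zero [simp]: "mprod K 0 A = 0" "mprod K B 0 = 0"
  by (auto simp: mprod_def fun_eq_iff)

lemma mtrace_simps [simp]: "mtrace K 0 = 0" "mtrace K (A + B) = mtrace K A + mtrace K B"
  "mtrace K (A - B) = mtrace K A - mtrace K B" "mtrace K (mscale c A) = c * mtrace K A"
  by (simp_all add: mtrace_def mscale_def sum.distrib sum_subtractf sum_distrib_left)

lemma mtrace_commute: "mtrace I (mprod J A B) = mtrace J (mprod I B A)"
  unfolding mtrace_def mprod_def by (subst sum.swap) (simp add: mult.commute)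

lemma mtrace_cong: "(\<And>i. i \<in> K \<Longrightarrow> A i i = B i i) \<Longrightarrow> mtrace K A = mtrace K B"
  by (simp add: mtrace_def)

lemma mprod_cong: "(\<And>k. k \<in> K \<Longrightarrow> A i k = A' i k) \<Longrightarrow> (\<And>k. k \<in> K \<Longrightarrow> B k j = B' k j) \<Longrightarrow>
  mprod K A B i j = mprod K A' B' i j"
  by (simp add: mprod_def)

text \<open>Invariance of the trace form \<open>(A, B) \<mapsto> tr (A B)\<close> on matrices.\<close>
lemma mtrace_commutator:
  "mtrace K (mprod K A (commutator K Y M)) = mtrace K (mprod K (commutator K A Y) M)"
proof -
  have "mtrace K (mprod K A (mprod K M Y)) = mtrace K (mprod K Y (mprod K A M))"
    using mtrace_commute[of K K "mprod K A M" Y] by (simp add: mprod_assoc)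
  then show ?thesis by (simp add: commutator_def mprod_diff mprod_assoc)
qed

interpretation matrix_space: vector_space "mscale :: 'f::field \<Rightarrow> ('i \<Rightarrow> 'j \<Rightarrow> 'f) \<Rightarrow> _"
  by standard (simp_all add: mscale_def fun_eq_iff algebra_simps)

interpretation commutator: linear_operator "mscale :: 'f::field \<Rightarrow> ('i \<Rightarrow> 'i \<Rightarrow> 'f) \<Rightarrow> _" "commutator K A" for K A
  by standard (simp_all add: commutator_def mprod_add mprod_mscale matrix_space.scale_right_diff_distrib)

text \<open>The shape of the matrix of an operator in a block-triangular basis.\<close>
locale block_triangular_matrix =
  fixes C :: "'c set" and J :: "'c \<Rightarrow> 'c \<Rightarrow> 'f::field" and ev :: "'c \<Rightarrow> 'f" and r :: "'c \<Rightarrow> nat"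
  assumes fin: "finite C"
    and diag: "c \<in> C \<Longrightarrow> J c c = ev c"
    and off_diag: "c \<in> C \<Longrightarrow> d \<in> C \<Longrightarrow> c \<noteq> d \<Longrightarrow> J c d \<noteq> 0 \<Longrightarrow> ev c = ev d \<and> r c < r d"
begin

text \<open>\<open>N\<close> is supported on the entries \<open>(i, j)\<close> with \<open>ev i - ev j = l\<close> whose distance \<open>Max r - r i + r j\<close> from
  the lower left corner is at least \<open>m\<close>. Each application of \<open>[J, _] - l\<close> raises \<open>m\<close>, as the diagonal of
  \<open>J\<close> contributes \<open>ev i - ev j - l = 0\<close>; this makes \<open>[J, _] - l\<close> nilpotent on matrices of weight \<open>l\<close>.\<close>
definition level :: "'f \<Rightarrow> nat \<Rightarrow> ('c \<Rightarrow> 'c \<Rightarrow> 'f) \<Rightarrow> bool" where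
  "level l m N \<longleftrightarrow> (\<forall>i\<in>C. \<forall>j\<in>C. N i j \<noteq> 0 \<longrightarrow>
     ev i - ev j = l \<and> m + r i \<le> Max (r ` C) + r j)"

lemma level_shift:
  assumes "level l m N"
  shows "level l (Suc m) (commutator.shift C J l N)"
  unfolding level_def
proof (intro ballI impI)
  fix i j assume ij: "i \<in> C" "j \<in> C" and ne: "commutator.shift C J l N i j \<noteq> 0"
  let ?S1 = "\<Sum>k\<in>C - {i}. J i k * N k j" and ?S2 = "\<Sum>k\<in>C - {j}. N i k * J k j"
  have "(\<Sum>k\<in>C. J i k * N k j) = ev i * N i j + ?S1" "(\<Sum>k\<in>C. N i k * J k j) = N i j * ev j + ?S2"
    using sum.remove[OF fin ij(1), of "\<lambda>k. J i k * N k j"] sum.remove[OF fin ij(2), of "\<lambda>k. N i k * J k j"]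
    by (simp_all add: diag ij)
  then have "commutator.shift C J l N i j = (ev i - ev j - l) * N i j + ?S1 - ?S2"
    by (simp add: commutator.shift_def commutator_def mprod_def mscale_def algebra_simps)
  moreover have "(ev i - ev j - l) * N i j = 0"
    using assms ij by (auto simp: level_def)
  ultimately have "?S1 \<noteq> 0 \<or> ?S2 \<noteq> 0" using ne by auto
  then show "ev i - ev j = l \<and> Suc m + r i \<le> Max (r ` C) + r j"
  proof
    assume "?S1 \<noteq> 0"
    then obtain k where "k \<in> C - {i}" "J i k * N k j \<noteq> 0"
      by (rule sum.not_neutral_contains_not_neutral)
    then have k: "k \<in> C" "k \<noteq> i" "J i k \<noteq> 0" "N k j \<noteq> 0" by auto
    then have "ev i = ev k \<and> r i < r k" using off_diag ij by metis
    moreover have "ev k - ev j = l \<and> m + r k \<le> Max (r ` C) + r j"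
      using assms k ij by (auto simp: level_def)
    ultimately show ?thesis by simp
  next
    assume "?S2 \<noteq> 0"
    then obtain k where "k \<in> C - {j}" "N i k * J k j \<noteq> 0"
      by (rule sum.not_neutral_contains_not_neutral)
    then have k: "k \<in> C" "k \<noteq> j" "J k j \<noteq> 0" "N i k \<noteq> 0" by auto
    then have "ev k = ev j \<and> r k < r j" using off_diag ij by metis
    moreover have "ev i - ev k = l \<and> m + r i \<le> Max (r ` C) + r k"
      using assms k ij by (auto simp: level_def)
    ultimately show ?thesis by simp
  qed
qed

text \<open>The matrix in the conclusion is the commutator of \<open>M\<close> with the diagonal matrix of the \<open>g (ev i)\<close>. Let
  \<open>u l\<close> be the part of \<open>M\<close> supported where \<open>ev i - ev j = l\<close>. It is a generalised eigenvector of
  \<open>[J, _]\<close> modulo matrices that vanish on \<open>C \<times> C\<close>, so it lies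
  in \<open>W\<close>; by additivity of \<open>g\<close> the commutator is the sum of the \<open>g l \<cdot> u l\<close>.\<close>
lemma additive_diagonal_preserves:
  assumes W: "matrix_space.subspace W" and inv: "\<And>M. M \<in> W \<Longrightarrow> commutator C J M \<in> W"
    and cong: "\<And>M N. M \<in> W \<Longrightarrow> (\<And>i j. i \<in> C \<Longrightarrow> j \<in> C \<Longrightarrow> M i j = N i j) \<Longrightarrow> N \<in> W"
    and g: "\<And>x y. g (x - y) = g x - g y" and M: "M \<in> W"
  shows "(\<lambda>i j. (g (ev i) - g (ev j)) * M i j) \<in> W"
proof -
  let ?F = "(\<lambda>(i, j). ev i - ev j) ` (C \<times> C)"
  let ?R = "Max (r ` C)"
  define u where "u = (\<lambda>l i j. if ev i - ev j = l then M i j else 0)"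
  have finF: "finite ?F" using fin by simp
  have r_le: "r c \<le> ?R" if "c \<in> C" for c using that fin by simp
  have sum_fun: "(\<Sum>l\<in>?F. f l) i j = (\<Sum>l\<in>?F. f l i j)" for f :: "'f \<Rightarrow> 'c \<Rightarrow> 'c \<Rightarrow> 'f" and i j
    using finF by (induction rule: finite_induct) simp_all
  have sum_u: "(\<Sum>l\<in>?F. mscale (g l) (u l)) i j = g (ev i - ev j) * M i j"
    if "i \<in> C" "j \<in> C" for g i j
  proof -
    have "(\<Sum>l\<in>?F. mscale (g l) (u l)) i j = (\<Sum>l\<in>?F. if l = ev i - ev j then g l * M i j else 0)"
      unfolding sum_fun by (intro sum.cong) (auto simp: mscale_def u_def)
    also have "\<dots> = g (ev i - ev j) * M i j" using that finF by (subst sum.delta) auto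
    finally show ?thesis .
  qed
  have "(commutator.shift C J l ^^ (2 * ?R + 1)) (u l) \<in> W" for l
  proof -
    \<comment> \<open>\<open>u l\<close> has level 0, and a matrix of level \<open>2 * ?R + 1\<close> has no non-zero entries in \<open>C \<times> C\<close>\<close>
    have "level l m ((commutator.shift C J l ^^ m) (u l))" for m
      by (induction m) (auto simp: level_shift level_def[of _ 0] u_def trans_le_add1 r_le)
    from this[of "2 * ?R + 1"] have "(commutator.shift C J l ^^ (2 * ?R + 1)) (u l) i j = 0"
      if "i \<in> C" "j \<in> C" for i j
      using that r_le[OF that(2)] unfolding level_def by fastforce
    then show ?thesis using cong[OF matrix_space.subspace_0[OF W]] by simp
  qed
  moreover have "sum u ?F \<in> W"
    using cong[OF M, of "sum u ?F"] sum_u[of _ _ "\<lambda>_. 1"] by simp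
  ultimately have "u l \<in> W" if "l \<in> ?F" for l
    using commutator.component_in_invariant_subspace[OF W inv finF _ _ that] by blast
  then have "(\<Sum>l\<in>?F. mscale (g l) (u l)) \<in> W"
    by (intro matrix_space.subspace_sum[OF W] matrix_space.subspace_scale[OF W])
  then show ?thesis
    by (rule cong) (simp add: sum_u g)
qed

end

lemma rational_functional:
  fixes x :: "'f::field_char_0"
  assumes "x \<noteq> 0"
  obtains f :: "'f \<Rightarrow> rat"
  where "\<And>a b. f (a + b) = f a + f b" "\<And>q a. f (of_rat q * a) = q * f a" "f x = 1"
proof -
  interpret P: vector_space_pair "\<lambda>q (a::'f). of_rat q * a" "\<lambda>(q::rat) (a::rat). q * a"
    by standard (simp_all add: algebra_simps of_rat_add of_rat_mult)
  have "P.vs1.independent {x}" using assms by simp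
  from P.linear_independent_extend[OF this, of "\<lambda>_. 1"] obtain f where
    f: "Vector_Spaces.linear (\<lambda>q (a::'f). of_rat q * a) (\<lambda>(q::rat) (a::rat). q * a) f" "f x = 1" by blast
  then show ?thesis
    using that[of f] by (simp add: Vector_Spaces.linear_iff)
qed

text \<open>Characteristic zero enters here. If \<open>ev c \<noteq> 0\<close>, choose a \<open>\<rat>\<close>-linear \<open>f\<close> into the rationals with
  \<open>f (ev c) = 1\<close> and apply \<open>f\<close> to the sum for \<open>g = f\<close>: the result is a vanishing sum of rational squares.\<close>
lemma trace_with_rational_parts_zero:
  fixes ev :: "'c \<Rightarrow> 'f::field_char_0"
  assumes fin: "finite C"
    and 0: "\<And>g. (\<And>x y. g (x - y) = g x - g y) \<Longrightarrow> (\<Sum>c\<in>C. g (ev c) * ev c) = 0"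
    and c: "c \<in> C"
  shows "ev c = 0"
proof (rule ccontr)
  assume "ev c \<noteq> 0"
  then obtain f :: "'f \<Rightarrow> rat" where f: "\<And>a b. f (a + b) = f a + f b"
    "\<And>q a. f (of_rat q * a) = q * f a" "f (ev c) = 1"
    using rational_functional by blast
  have f0: "f 0 = 0" using f(1)[of 0 0] by simp
  have f_diff: "f (a - b) = f a - f b" for a b
    using f(1)[of "a - b" b] by simp
  have f_sum: "f (sum h C) = (\<Sum>c\<in>C. f (h c))" for h
    by (induction C rule: infinite_finite_induct) (simp_all add: f0 f(1))
  have "(\<Sum>c\<in>C. f (ev c) ^ 2) = f (\<Sum>c\<in>C. of_rat (f (ev c)) * ev c)"
    by (simp add: f_sum f(2) power2_eq_square)
  also have "\<dots> = 0"
    by (subst 0) (simp_all add: f_diff of_rat_diff f0)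
  finally have "f (ev c) ^ 2 = 0"
    using fin c by (subst (asm) sum_nonneg_eq_0_iff) auto
  then show False using f(3) by simp
qed

section \<open>A trace criterion for nilpotency\<close>

definition vscale :: "'f::field \<Rightarrow> ('i \<Rightarrow> 'f) \<Rightarrow> 'i \<Rightarrow> 'f" where
  "vscale c v = (\<lambda>i. c * v i)"

definition mapply :: "'i set \<Rightarrow> ('i \<Rightarrow> 'i \<Rightarrow> 'f::field) \<Rightarrow> ('i \<Rightarrow> 'f) \<Rightarrow> 'i \<Rightarrow> 'f" where
  "mapply B A v = (\<lambda>i. if i \<in> B then \<Sum>j\<in>B. A i j * v j else 0)"

interpretation coord: vector_space "vscale :: 'f::field \<Rightarrow> ('i \<Rightarrow> 'f) \<Rightarrow> _"
  by standard (simp_all add: vscale_def fun_eq_iff algebra_simps)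

interpretation mapply: linear_operator "vscale :: 'f::field \<Rightarrow> ('i \<Rightarrow> 'f) \<Rightarrow> _" "mapply B A" for B A
  by standard (simp_all add: mapply_def vscale_def fun_eq_iff algebra_simps sum.distrib sum_distrib_left)

interpretation mapply: alg_closed_operator "vscale :: 'f::alg_closed_field \<Rightarrow> ('i \<Rightarrow> 'f) \<Rightarrow> _" "mapply B A" for B A
  by unfold_locales

definition unit_vec :: "'i \<Rightarrow> 'i \<Rightarrow> 'f::field" where
  "unit_vec j = (\<lambda>i. if i = j then 1 else 0)"

lemma supported_eq_sum_units:
  fixes v :: "'i \<Rightarrow> 'f::field"
  assumes B: "finite B" and v: "\<And>i. i \<notin> B \<Longrightarrow> v i = 0"
  shows "(\<Sum>j\<in>B. vscale (v j) (unit_vec j)) = v"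
proof
  fix i
  have sum_fun: "(\<Sum>j\<in>B. f j) i = (\<Sum>j\<in>B. f j i)" for f :: "'i \<Rightarrow> 'i \<Rightarrow> 'f"
    using B by (induction rule: finite_induct) simp_all
  have "(\<Sum>j\<in>B. vscale (v j) (unit_vec j)) i = (\<Sum>j\<in>B. if i = j then v j else 0)"
    unfolding sum_fun by (intro sum.cong) (auto simp: vscale_def unit_vec_def)
  also have "\<dots> = v i" using B v by (subst sum.delta') auto
  finally show "(\<Sum>j\<in>B. vscale (v j) (unit_vec j)) i = v i" .
qed

text \<open>All functions on the index type form the ambient space, which may have infinite dimension; vectors
  supported in \<open>B\<close> play the role of the coordinate space.\<close>
lemma in_span_units_iff:
  fixes v :: "'i \<Rightarrow> 'f::field"
  assumes B: "finite B"
  shows "v \<in> coord.span (unit_vec ` B) \<longleftrightarrow> (\<forall>i. i \<notin> B \<longrightarrow> v i = 0)"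
proof
  assume "v \<in> coord.span (unit_vec ` B)"
  then show "\<forall>i. i \<notin> B \<longrightarrow> v i = 0"
    by (induction rule: coord.span_induct_alt) (auto simp: vscale_def unit_vec_def split: if_splits)
next
  assume "\<forall>i. i \<notin> B \<longrightarrow> v i = 0"
  then have "(\<Sum>j\<in>B. vscale (v j) (unit_vec j)) = v" by (intro supported_eq_sum_units B) auto
  then show "v \<in> coord.span (unit_vec ` B)"
    by (metis (no_types, lifting) coord.span_sum coord.span_scale coord.span_base imageI)
qed

text \<open>\<open>J\<close> is the matrix \<open>A\<close> after the change of basis with \<open>P\<close> and its inverse \<open>Q\<close>. The two index sets are
  unrelated, so the new basis vectors can themselves serve as indices.\<close>
locale block_triangular_form = block_triangular_matrix C J ev r
  for C :: "'c set" and J :: "'c \<Rightarrow> 'c \<Rightarrow> 'f::field" and ev r +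
  fixes B :: "'i set" and A :: "'i \<Rightarrow> 'i \<Rightarrow> 'f" and P :: "'i \<Rightarrow> 'c \<Rightarrow> 'f" and Q :: "'c \<Rightarrow> 'i \<Rightarrow> 'f"
  assumes B: "finite B"
    and PQ: "i \<in> B \<Longrightarrow> j \<in> B \<Longrightarrow> mprod C P Q i j = (if i = j then 1 else 0)"
    and QP: "c \<in> C \<Longrightarrow> d \<in> C \<Longrightarrow> mprod B Q P c d = (if c = d then 1 else 0)"
    and J: "c \<in> C \<Longrightarrow> d \<in> C \<Longrightarrow> J c d = mprod B Q (mprod B A P) c d"
begin

text \<open>\<open>M \<mapsto> P M Q\<close> is an isomorphism of matrix algebras, so the hypotheses can be transported to the
  block-triangular \<open>J\<close>. There \<open>D\<close> is the diagonal matrix with entries \<open>g (ev c)\<close>, and the trace of \<open>J D\<close>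
  is the sum in the conclusion.\<close>
lemma additive_trace_zero:
  assumes W: "matrix_space.subspace W" and inv: "\<And>M. M \<in> W \<Longrightarrow> commutator B A M \<in> W"
    and cong: "\<And>M N. M \<in> W \<Longrightarrow> (\<And>i j. i \<in> B \<Longrightarrow> j \<in> B \<Longrightarrow> M i j = N i j) \<Longrightarrow> N \<in> W"
    and trace: "\<And>D. (\<And>M. M \<in> W \<Longrightarrow> commutator B D M \<in> W) \<Longrightarrow> mtrace B (mprod B A D) = 0"
    and g: "\<And>x y. g (x - y) = g x - g y"
  shows "(\<Sum>c\<in>C. g (ev c) * ev c) = 0"
proof -
  have left_1: "mprod K U M i j = M i j" if "finite K" "i \<in> K" "\<And>k. k \<in> K \<Longrightarrow> U i k = (if i = k then 1 else 0)"
    for K :: "'x set" and U and M :: "'x \<Rightarrow> 'y \<Rightarrow> 'f" and i j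
    using that by (simp add: mprod_def if_distrib[of "\<lambda>x. x * _"] cong: if_cong)
  have right_1: "mprod K M U i j = M i j" if "finite K" "j \<in> K" "\<And>k. k \<in> K \<Longrightarrow> U k j = (if k = j then 1 else 0)"
    for K :: "'x set" and U and M :: "'y \<Rightarrow> 'x \<Rightarrow> 'f" and i j
    using that by (simp add: mprod_def if_distrib[of "\<lambda>x. _ * x"] cong: if_cong)
  define conj where "conj = (\<lambda>N. mprod C P (mprod C N Q))"
  have JQ: "mprod C J Q c j = mprod B Q A c j" if "c \<in> C" "j \<in> B" for c j
  proof -
    have "mprod C J Q c j = mprod C (mprod B (mprod B Q A) P) Q c j"
      by (rule mprod_cong) (simp_all add: J that mprod_assoc)
    also have "\<dots> = mprod B (mprod B Q A) (mprod C P Q) c j" by (simp add: mprod_assoc)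
    also have "\<dots> = mprod B Q A c j" by (rule right_1) (use that B PQ in auto)
    finally show ?thesis .
  qed
  have conj_mult: "mprod B (conj M) (conj N) i j = conj (mprod C M N) i j" for M N i j
  proof -
    have "mprod B (conj M) (conj N) i j = mprod C P (mprod C M (mprod C (mprod B Q P) (mprod C N Q))) i j"
      by (simp add: conj_def mprod_assoc)
    also have "\<dots> = mprod C P (mprod C M (mprod C N Q)) i j"
      by (intro mprod_cong refl left_1) (use fin QP in auto)
    finally show ?thesis by (simp add: conj_def mprod_assoc)
  qed
  have conj_comm: "commutator B (conj M) (conj N) = conj (commutator C M N)" for M N
    by (intro ext) (simp add: commutator_def conj_mult, simp add: conj_def mprod_diff)
  have conj_J: "conj J i j = A i j" if "i \<in> B" "j \<in> B" for i j
  proof -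
    have "conj J i j = mprod C P (mprod B Q A) i j"
      unfolding conj_def by (rule mprod_cong) (simp_all add: JQ that)
    also have "\<dots> = mprod B (mprod C P Q) A i j" by (simp add: mprod_assoc)
    also have "\<dots> = A i j" by (rule left_1) (use that B PQ in auto)
    finally show ?thesis .
  qed
  have comm_cong: "commutator B M N i j = commutator B M' N' i j"
    if "i \<in> B" "j \<in> B" "\<And>i j. i \<in> B \<Longrightarrow> j \<in> B \<Longrightarrow> M i j = M' i j" "\<And>i j. i \<in> B \<Longrightarrow> j \<in> B \<Longrightarrow> N i j = N' i j"
    for M N M' N' and i j
    using that by (simp add: commutator_def mprod_def)
  have conj_onto: "\<exists>N. \<forall>i\<in>B. \<forall>j\<in>B. conj N i j = M i j" for M
  proof (intro exI ballI)
    fix i j assume ij: "i \<in> B" "j \<in> B"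
    have "conj (mprod B Q (mprod B M P)) i j = mprod B (mprod C P Q) (mprod B M (mprod C P Q)) i j"
      by (simp add: conj_def mprod_assoc)
    also have "\<dots> = mprod B M (mprod C P Q) i j" by (rule left_1) (use ij B PQ in auto)
    also have "\<dots> = M i j" by (rule right_1) (use ij B PQ in auto)
    finally show "conj (mprod B Q (mprod B M P)) i j = M i j" .
  qed
  have conj_lin: "conj 0 = 0" "conj (M + N) = conj M + conj N" "conj (mscale a M) = mscale a (conj M)" for M N a
    by (simp_all add: conj_def mprod_add mprod_mscale)
  define W' where "W' = {N. conj N \<in> W}"
  have W': "matrix_space.subspace W'"
    using W by (auto simp: W'_def matrix_space.subspace_def conj_lin)
  have inv': "commutator C J N \<in> W'" if "N \<in> W'" for N
  proof -
    have "commutator B A (conj N) \<in> W" using that inv by (simp add: W'_def)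
    then have "commutator B (conj J) (conj N) \<in> W"
      by (rule cong) (rule comm_cong, simp_all add: conj_J)
    then show ?thesis by (simp add: W'_def conj_comm)
  qed
  have cong': "N \<in> W'" if "M \<in> W'" "\<And>i j. i \<in> C \<Longrightarrow> j \<in> C \<Longrightarrow> M i j = N i j" for M N
  proof -
    have "conj M = conj N" unfolding conj_def mprod_def using that(2) by simp
    then show ?thesis using that(1) by (simp add: W'_def)
  qed
    define D where "D = (\<lambda>c d. if c = d then g (ev c) else 0 :: 'f)"
    have D_comm: "commutator C D N i j = (g (ev i) - g (ev j)) * N i j" if "i \<in> C" "j \<in> C" for N i j
      using that fin by (simp add: commutator_def mprod_def D_def if_distrib[of "\<lambda>x. x * _"]
          if_distrib[of "\<lambda>x. _ * x"] algebra_simps cong: if_cong)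
    have "commutator B (conj D) M \<in> W" if M: "M \<in> W" for M
    proof -
      obtain N where N: "\<forall>i\<in>B. \<forall>j\<in>B. conj N i j = M i j" using conj_onto by blast
      have "conj N \<in> W" by (rule cong[OF M]) (use N in simp)
      then have "N \<in> W'" by (simp add: W'_def)
      then have "(\<lambda>i j. (g (ev i) - g (ev j)) * N i j) \<in> W'"
        by (intro additive_diagonal_preserves[OF W' inv' cong' g])
      then have "commutator C D N \<in> W'" by (rule cong') (simp add: D_comm)
      then have "commutator B (conj D) (conj N) \<in> W" by (simp add: W'_def conj_comm)
      then show ?thesis by (rule cong) (rule comm_cong, simp_all add: N)
    qed
    then have "0 = mtrace B (mprod B A (conj D))" by (simp add: trace)
    also have "\<dots> = mtrace B (mprod B (conj J) (conj D))"
      by (rule mtrace_cong, rule mprod_cong) (simp_all add: conj_J)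
    also have "\<dots> = mtrace B (mprod C P (mprod C (mprod C J D) Q))"
      by (rule mtrace_cong) (simp add: conj_mult, simp add: conj_def)
    also have "\<dots> = mtrace C (mprod C (mprod C J D) (mprod B Q P))"
      by (simp add: mtrace_commute[of B C] mprod_assoc)
    also have "\<dots> = mtrace C (mprod C J D)"
      by (rule mtrace_cong, rule right_1) (use fin QP in auto)
    also have "\<dots> = (\<Sum>c\<in>C. g (ev c) * ev c)"
      using fin by (simp add: mtrace_def mprod_def D_def diag if_distrib[of "\<lambda>x. _ * x"] mult.commute cong: if_cong)
    finally show ?thesis by simp
qed

end

text \<open>The columns of \<open>P\<close> are the vectors of a block-triangular basis, and \<open>Q\<close> reads off coordinates in it.\<close>
lemma block_triangular_form_exists:
  fixes A :: "'i \<Rightarrow> 'i \<Rightarrow> 'f::alg_closed_field"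
  assumes B: "finite B"
  obtains C :: "('i \<Rightarrow> 'f) set" and P Q J ev r where
    "block_triangular_form C J ev r B A P Q"
    "(\<forall>c\<in>C. ev c = 0) \<longrightarrow> (\<exists>m. \<forall>v. (\<forall>i. i \<notin> B \<longrightarrow> v i = 0) \<longrightarrow> (mapply B A ^^ m) v = 0)"
proof -
  let ?E = "unit_vec ` B :: ('i \<Rightarrow> 'f) set" and ?T = "mapply B A"
  have inv: "?T v \<in> coord.span ?E" for v
    using B by (simp add: in_span_units_iff mapply_def)
  obtain C ev r where js: "mapply.block_triangular_basis B A C ev r" and C: "coord.span C = coord.span ?E"
    using mapply.block_triangular_basis_exists[of ?E] B inv by blast
  have finC: "finite C" and ind: "coord.independent C"
    and tri: "\<And>c. c \<in> C \<Longrightarrow> ?T c - vscale (ev c) c \<in> coord.span {c'\<in>C. ev c' = ev c \<and> r c' < r c}"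
    using js by (auto simp: mapply.block_triangular_basis_def)
  let ?rep = "coord.representation C"
  define P :: "'i \<Rightarrow> ('i \<Rightarrow> 'f) \<Rightarrow> 'f" where "P = (\<lambda>i c. c i)"
  define Q where "Q = (\<lambda>c i. ?rep (unit_vec i) c)"
  define J where "J = (\<lambda>c d. ?rep (?T d) c)"
  have unit_in: "unit_vec j \<in> coord.span C" if "j \<in> B" for j
    using that C by (simp add: coord.span_base)
  have C_in: "c \<in> coord.span C" if "c \<in> C" for c using that by (rule coord.span_base)
  have supp: "v i = 0" if "v \<in> coord.span C" "i \<notin> B" for v i
    using that in_span_units_iff[OF B, of v] C by auto
  have sum_fun: "(\<Sum>j\<in>C. f j) i = (\<Sum>j\<in>C. f j i)" for f :: "_ \<Rightarrow> 'i \<Rightarrow> 'f" and i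
    using finC by (induction rule: finite_induct) simp_all
  have expand: "(\<Sum>c\<in>C. ?rep v c * c i) = v i" if "v \<in> coord.span C" for v i
    using fun_cong[OF coord.sum_representation_eq[OF ind that finC order_refl], of i]
    by (simp add: sum_fun vscale_def)
  have coords: "(\<Sum>i\<in>B. ?rep (unit_vec i) c * v i) = ?rep v c" if "v \<in> coord.span C" for v c
  proof -
    have "?rep v c = ?rep (\<Sum>j\<in>B. vscale (v j) (unit_vec j)) c"
      using supported_eq_sum_units[OF B, of v] supp[OF that] by simp
    also have "\<dots> = (\<Sum>j\<in>B. ?rep (vscale (v j) (unit_vec j)) c)"
      by (subst coord.representation_sum[OF ind]) (simp_all add: coord.span_scale unit_in)
    also have "\<dots> = (\<Sum>j\<in>B. ?rep (unit_vec j) c * v j)"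
      by (intro sum.cong) (simp_all add: coord.representation_scale[OF ind] unit_in)
    finally show ?thesis by simp
  qed
  have rep_basis: "?rep d c = (if c = d then 1 else 0)" if "d \<in> C" for c d
    by (simp add: coord.representation_basis[OF ind that])
  have T_in: "?T v \<in> coord.span C" for v using inv C by simp
  show ?thesis
  proof (rule that[of C J ev r P Q])
    have key: "ev c = ev d \<and> r c < r d"
      if d: "d \<in> C" and ne: "J c d - ev d * (if c = d then 1 else 0) \<noteq> 0" for c d
    proof -
      let ?S = "{c'\<in>C. ev c' = ev d \<and> r c' < r d}"
      have "?rep (?T d - vscale (ev d) d) = coord.representation ?S (?T d - vscale (ev d) d)"
        by (rule coord.representation_extend[OF ind tri[OF d]]) blast
      moreover have "?rep (?T d - vscale (ev d) d) c = J c d - ev d * (if c = d then 1 else 0)"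
        by (simp add: coord.representation_diff[OF ind] coord.representation_scale[OF ind]
            coord.span_scale C_in d T_in rep_basis J_def)
      ultimately have "c \<in> ?S"
        using ne coord.representation_ne_zero[of ?S "?T d - vscale (ev d) d" c] by simp
      then show ?thesis by blast
    qed
    show "block_triangular_form C J ev r B A P Q"
    proof
      show "J c c = ev c" if "c \<in> C" for c using key[of c c] that by auto
      show "ev c = ev d \<and> r c < r d" if "c \<in> C" "d \<in> C" "c \<noteq> d" "J c d \<noteq> 0" for c d
        using key[of d c] that by simp
      show "finite C" "finite B" by (rule finC, rule B)
    next
    fix i j assume "i \<in> B" "j \<in> B"
    then show "mprod C P Q i j = (if i = j then 1 else 0)"
      using expand[OF unit_in, of j i] by (simp add: mprod_def P_def Q_def mult.commute unit_vec_def)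
  next
    fix c d assume cd: "c \<in> C" "d \<in> C"
    show "mprod B Q P c d = (if c = d then 1 else 0)"
      using coords[OF C_in[OF cd(2)], of c] rep_basis[OF cd(2), of c] by (simp add: mprod_def P_def Q_def)
    have "J c d = (\<Sum>i\<in>B. ?rep (unit_vec i) c * ?T d i)" by (simp add: J_def coords[OF T_in])
    then show "J c d = mprod B Q (mprod B A P) c d"
      by (simp add: mprod_def Q_def P_def mapply_def)
    qed
  next
    show "(\<forall>c\<in>C. ev c = 0) \<longrightarrow> (\<exists>m. \<forall>v. (\<forall>i. i \<notin> B \<longrightarrow> v i = 0) \<longrightarrow> (?T ^^ m) v = 0)"
    proof
      assume "\<forall>c\<in>C. ev c = 0"
      then obtain m where m: "\<forall>v\<in>coord.span C. (?T ^^ m) v = 0"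
        using mapply.nilpotent_if_eigenvalues_0[OF js] by blast
      show "\<exists>m. \<forall>v. (\<forall>i. i \<notin> B \<longrightarrow> v i = 0) \<longrightarrow> (?T ^^ m) v = 0"
      proof (intro exI[of _ m] allI impI)
        fix v :: "'i \<Rightarrow> 'f" assume "\<forall>i. i \<notin> B \<longrightarrow> v i = 0"
        then have "v \<in> coord.span C" unfolding C by (simp add: in_span_units_iff[OF B])
        then show "(?T ^^ m) v = 0" using m by blast
      qed
    qed
  qed
qed

text \<open>The linear algebra behind Cartan's criterion. The congruence hypothesis says that membership in \<open>W\<close>
  depends only on the entries indexed by \<open>B\<close>.\<close>
theorem nilpotent_if_trace_zero:
  fixes A :: "'i \<Rightarrow> 'i \<Rightarrow> 'f::{alg_closed_field, field_char_0}"
  assumes B: "finite B"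
    and W: "matrix_space.subspace W" and inv: "\<And>M. M \<in> W \<Longrightarrow> commutator B A M \<in> W"
    and cong: "\<And>M N. M \<in> W \<Longrightarrow> (\<And>i j. i \<in> B \<Longrightarrow> j \<in> B \<Longrightarrow> M i j = N i j) \<Longrightarrow> N \<in> W"
    and trace: "\<And>D. (\<And>M. M \<in> W \<Longrightarrow> commutator B D M \<in> W) \<Longrightarrow> mtrace B (mprod B A D) = 0"
  shows "\<exists>m. \<forall>v. (\<forall>i. i \<notin> B \<longrightarrow> v i = 0) \<longrightarrow> (mapply B A ^^ m) v = 0"
proof (rule block_triangular_form_exists[OF B, of A])
  fix C :: "('i \<Rightarrow> 'f) set" and P Q J ev r
  assume jf: "block_triangular_form C J ev r B A P Q"
    and nil: "(\<forall>c\<in>C. ev c = 0) \<longrightarrow> (\<exists>m. \<forall>v. (\<forall>i. i \<notin> B \<longrightarrow> v i = 0) \<longrightarrow> (mapply B A ^^ m) v = 0)"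
  interpret block_triangular_form C J ev r B A P Q by (rule jf)
  have "ev c = 0" if "c \<in> C" for c
    by (rule trace_with_rational_parts_zero[OF fin _ that])
      (rule additive_trace_zero[OF W inv cong trace])
  then show ?thesis using nil by blast
qed

section \<open>Engel's theorem for Leibniz algebras\<close>

locale finite_dimensional_leibniz_algebra =
  leibniz_algebra scale br + finite_dimensional_vector_space scale Basis
  for scale :: "'k::field \<Rightarrow> 'a::ab_group_add \<Rightarrow> 'a" and br and Basis
begin

text \<open>The operators \<open>R\<^sub>x\<close>, \<open>x \<in> H\<close>, have a common null vector in every non-zero quotient \<open>W / U\<close> of invariant
  subspaces. Stating this for all such quotients makes it inheritable from \<open>H\<close> to larger subalgebras.\<close>
definition engel :: "'a set \<Rightarrow> bool" where
  "engel H \<longleftrightarrow> (\<forall>U W. subspace U \<longrightarrow> subspace W \<longrightarrow> U \<subset> W \<longrightarrow>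
     (\<forall>x\<in>H. \<forall>u\<in>U. br u x \<in> U) \<longrightarrow> (\<forall>x\<in>H. \<forall>w\<in>W. br w x \<in> W) \<longrightarrow>
     (\<exists>w\<in>W - U. \<forall>x\<in>H. br w x \<in> U))"

lemma engelD:
  assumes "engel H" "subspace U" "subspace W" "U \<subset> W"
    "\<And>x u. x \<in> H \<Longrightarrow> u \<in> U \<Longrightarrow> br u x \<in> U" "\<And>x w. x \<in> H \<Longrightarrow> w \<in> W \<Longrightarrow> br w x \<in> W"
  obtains w where "w \<in> W" "w \<notin> U" "\<And>x. x \<in> H \<Longrightarrow> br w x \<in> U"
  using assms unfolding engel_def by (metis DiffE)

lemma br_span_insert_mem:
  assumes U: "subspace U" and H: "subspace H" and x: "x \<in> span (insert y H)"
    and "br v y \<in> U" "\<And>h. h \<in> H \<Longrightarrow> br v h \<in> U"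
  shows "br v x \<in> U"
  using x
proof (induction rule: span_induct_alt)
  case base
  then show ?case by (simp add: br_zero_right subspace_0[OF U])
next
  case (step c s t)
  then have "br v s \<in> U" using assms by auto
  then show ?case
    using step by (simp add: br_add_right br_scale_right subspace_add[OF U] subspace_scale[OF U])
qed

text \<open>The vectors of \<open>W\<close> that \<open>H\<close> sends into \<open>U\<close> form a space that is invariant under \<open>R\<^sub>y\<close>, since \<open>y\<close>
  normalises \<open>H\<close>. As \<open>R\<^sub>y\<close> is nilpotent, the last of the iterates of one of them that is outside \<open>U\<close> is
  sent into \<open>U\<close> by \<open>y\<close> as well.\<close>
lemma engel_insert:
  assumes H: "subspace H" "engel H" and norm: "\<And>x. x \<in> H \<Longrightarrow> br y x \<in> H"
    and nil: "\<And>v. ((\<lambda>v. br v y) ^^ m) v = 0"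
  shows "engel (span (insert y H))"
  unfolding engel_def
proof (intro allI impI)
  fix U W
  assume U: "subspace U" and W: "subspace W" and UW: "U \<subset> W"
    and U_inv: "\<forall>x\<in>span (insert y H). \<forall>u\<in>U. br u x \<in> U"
    and W_inv: "\<forall>x\<in>span (insert y H). \<forall>u\<in>W. br u x \<in> W"
  have y_in: "y \<in> span (insert y H)" and H_sub: "h \<in> H \<Longrightarrow> h \<in> span (insert y H)" for h
    by (auto intro: span_base)
  obtain v where v: "v \<in> W" "v \<notin> U" "\<And>x. x \<in> H \<Longrightarrow> br v x \<in> U"
    by (rule engelD[OF H(2) U W UW]) (use U_inv W_inv H_sub in auto)
  define V where "V = {v \<in> W. \<forall>x\<in>H. br v x \<in> U}"
  have V_y: "br u y \<in> V" if "u \<in> V" for u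
  proof -
    have "br (br u y) x \<in> U" if "x \<in> H" for x
    proof -
      have "br (br u y) x = br (br u x) y + br u (br y x)" by (rule leibniz_identity)
      moreover have "br (br u x) y \<in> U" "br u (br y x) \<in> U"
        using \<open>u \<in> V\<close> \<open>x \<in> H\<close> U_inv y_in norm by (auto simp: V_def)
      ultimately show ?thesis by (simp add: subspace_add[OF U])
    qed
    then show ?thesis using that W_inv y_in by (auto simp: V_def)
  qed
  \<comment> \<open>an iterate outside \<open>U\<close> whose successor is in \<open>U\<close>\<close>
  let ?f = "\<lambda>k. ((\<lambda>v. br v y) ^^ k) v"
  have f_V: "?f k \<in> V" for k by (induction k) (use v V_y in \<open>auto simp: V_def\<close>)
  have "?f m \<in> U" using nil subspace_0[OF U] by simp
  then obtain k where k: "?f k \<notin> U" "?f (Suc k) \<in> U"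
    using v(2) by (induction m) auto
  have "br (?f k) x \<in> U" if "x \<in> span (insert y H)" for x
    by (rule br_span_insert_mem[OF U H(1) that]) (use k f_V[of k] in \<open>auto simp: V_def\<close>)
  then show "\<exists>w\<in>W - U. \<forall>x\<in>span (insert y H). br w x \<in> U"
    using k(1) f_V[of k] by (intro bexI[of _ "?f k"]) (auto simp: V_def)
qed

text \<open>Take a subalgebra \<open>H\<close> of greatest dimension with the Engel property that contains all squares of \<open>N\<close>.
  Squares act by zero from the right, so their span is a first example, and modulo \<open>H\<close> the product
  of \<open>N\<close> is anticommutative. If \<open>H \<noteq> N\<close>, the Engel property for the action of \<open>H\<close> on \<open>N / H\<close> yields a
  vector \<open>w \<notin> H\<close> with \<open>[w, H] \<subseteq> H\<close>, and \<open>H + \<langle>w\<rangle>\<close> is a larger subalgebra with the Engel property.\<close>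
theorem engel_if_right_nilpotent:
  assumes N: "subspace N" "\<And>x y. x \<in> N \<Longrightarrow> y \<in> N \<Longrightarrow> br x y \<in> N"
    and nil: "\<And>x. x \<in> N \<Longrightarrow> \<exists>m. \<forall>v. ((\<lambda>v. br v x) ^^ m) v = 0"
  shows "engel N"
proof -
  let ?sq = "{br x x |x. x \<in> N}"
  let ?P = "\<lambda>H. subspace H \<and> ?sq \<subseteq> H \<and> H \<subseteq> N \<and> (\<forall>x\<in>H. \<forall>y\<in>H. br x y \<in> H) \<and> engel H"
  have right_0: "br v x = 0" if "x \<in> span ?sq" for v x
    using that by (induction rule: span_induct_alt)
      (auto simp: br_zero_right br_add_right br_scale_right br_square_right)
  have "?P (span ?sq)"
  proof (intro conjI)
    show "span ?sq \<subseteq> N" using N by (intro span_minimal) auto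
    show "engel (span ?sq)"
      unfolding engel_def
    proof (intro allI impI)
      fix U W :: "'a set" assume "subspace U" "U \<subset> W"
      then show "\<exists>w\<in>W - U. \<forall>x\<in>span ?sq. br w x \<in> U"
        using subspace_0 right_0 by auto
    qed
  qed (auto simp: right_0 span_zero intro: span_base)
  moreover have "\<forall>H. ?P H \<longrightarrow> dim H < Suc (dim UNIV)"
    using dim_subset[OF subset_UNIV] by (simp add: less_Suc_eq_le)
  ultimately have "\<exists>H. ?P H \<and> (\<forall>H'. ?P H' \<longrightarrow> dim H' \<le> dim H)"
    by (rule Lattices_Big.ex_has_greatest_nat)
  then obtain H where H: "?P H" and max: "\<And>H'. ?P H' \<Longrightarrow> dim H' \<le> dim H" by blast
  have "H = N"
  proof (rule ccontr)
    assume "H \<noteq> N"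
    then have HN: "H \<subset> N" using H by blast
    obtain w where w: "w \<in> N" "w \<notin> H" "\<And>x. x \<in> H \<Longrightarrow> br w x \<in> H"
      by (rule engelD[of H H N]) (use H HN N in auto)
    obtain m where m: "\<And>v. ((\<lambda>v. br v w) ^^ m) v = 0" using nil[OF w(1)] by blast
    let ?H = "span (insert w H)"
    have subH: "subspace H" using H by blast
    have H_in: "H \<subseteq> ?H" and w_in: "w \<in> ?H" by (auto intro: span_base)
    have sq: "br x x \<in> H" if "x \<in> N" for x using H that by blast
    have x_w: "br x w \<in> H" if "x \<in> H" for x
    proof -
      have "x \<in> N" using H that by blast
      then have "x + w \<in> N" using w N by (simp add: subspace_add)
      have "br x w = br (x + w) (x + w) - br x x - br w w - br w x"
        by (simp add: br_add_left br_add_right)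
      moreover have "br (x + w) (x + w) \<in> H" "br x x \<in> H" "br w w \<in> H" "br w x \<in> H"
        using sq[OF \<open>x + w \<in> N\<close>] sq[OF \<open>x \<in> N\<close>] sq[OF w(1)] w(3)[OF that] .
      ultimately show ?thesis by (simp add: subspace_diff[OF subH])
    qed
    have mult: "br x y \<in> ?H" if "x \<in> ?H" "y \<in> ?H" for x y
    proof (rule br_span_insert_mem[OF subspace_span subH that(2)])
      have left: "br x z \<in> ?H" if z: "br w z \<in> H" "\<And>h. h \<in> H \<Longrightarrow> br h z \<in> H" for z
        using \<open>x \<in> ?H\<close>
      proof (induction rule: span_induct_alt)
        case (step c s t)
        then have "br s z \<in> ?H" using z H_in by auto
        then show ?case using step by (simp add: br_add_left br_scale_left span_add span_scale)
      qed (simp add: br_zero_left span_zero)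
      show "br x w \<in> ?H" by (rule left) (use sq[OF w(1)] x_w in auto)
      show "br x h \<in> ?H" if "h \<in> H" for h by (rule left) (use w(3) H that in auto)
    qed
    have "?H \<subseteq> N" using H w N(1) by (intro span_minimal) auto
    moreover have "engel ?H" by (rule engel_insert[OF subH _ w(3) m]) (use H in auto)
    ultimately have "?P ?H" using H H_in mult by auto
    then have "dim ?H \<le> dim H" by (rule max)
    then have "H = ?H" by (intro subspace_dim_equal subH subspace_span H_in)
    then show False using w_in w(2) by blast
  qed
  then show ?thesis using H by blast
qed

text \<open>Let \<open>U\<close> be a proper subspace of \<open>N\<close> of greatest dimension with \<open>[U, N] \<subseteq> U\<close>. Engel's theorem gives
  \<open>w \<in> N - U\<close> with \<open>[w, N] \<subseteq> U\<close>; by maximality \<open>U + \<langle>w\<rangle> = N\<close>, and so \<open>[N, N] \<subseteq> U\<close>.\<close>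
theorem right_nilpotent_not_perfect:
  assumes N: "subspace N" "\<And>x y. x \<in> N \<Longrightarrow> y \<in> N \<Longrightarrow> br x y \<in> N" "N \<noteq> {0}"
    and nil: "\<And>x. x \<in> N \<Longrightarrow> \<exists>m. \<forall>v. ((\<lambda>v. br v x) ^^ m) v = 0"
  shows "span {br x y |x y. x \<in> N \<and> y \<in> N} \<subset> N"
proof -
  let ?P = "\<lambda>U. subspace U \<and> U \<subset> N \<and> (\<forall>x\<in>N. \<forall>u\<in>U. br u x \<in> U)"
  have "?P {0}" using N(1,3) subspace_0[OF N(1)] by (auto simp: br_zero_left)
  moreover have "\<forall>U. ?P U \<longrightarrow> dim U < Suc (dim UNIV)"
    using dim_subset[OF subset_UNIV] by (simp add: less_Suc_eq_le)
  ultimately have "\<exists>U. ?P U \<and> (\<forall>U'. ?P U' \<longrightarrow> dim U' \<le> dim U)"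
    by (rule Lattices_Big.ex_has_greatest_nat)
  then obtain U where U: "?P U" and max: "\<And>U'. ?P U' \<Longrightarrow> dim U' \<le> dim U" by blast
  have subU: "subspace U" using U by blast
  obtain w where w: "w \<in> N" "w \<notin> U" "\<And>x. x \<in> N \<Longrightarrow> br w x \<in> U"
    by (rule engelD[OF engel_if_right_nilpotent[OF N(1,2) nil], of U N]) (use U N in auto)
  let ?U = "span (insert w U)"
  have br_U: "br u x \<in> U" if "u \<in> ?U" "x \<in> N" for u x
    using that(1)
  proof (induction rule: span_induct_alt)
    case (step c s t)
    then have "br s x \<in> U" using w(3) U that(2) by auto
    then show ?case using step by (simp add: br_add_left br_scale_left subspace_add[OF subU] subspace_scale[OF subU])
  qed (simp add: br_zero_left subspace_0[OF subU])
  have U_in: "U \<subseteq> ?U" and w_in: "w \<in> ?U" by (auto intro: span_base)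
  have "?U \<subseteq> N" using w N(1) U by (intro span_minimal) auto
  moreover have "\<not> ?P ?U"
  proof
    assume "?P ?U"
    then have "dim ?U \<le> dim U" by (rule max)
    then have "U = ?U" by (intro subspace_dim_equal subU subspace_span U_in)
    then show False using w_in w(2) by blast
  qed
  ultimately have "?U = N" using br_U U_in by auto
  then have "span {br x y |x y. x \<in> N \<and> y \<in> N} \<subseteq> U"
    using br_U by (intro span_minimal subU) auto
  then show ?thesis using U by blast
qed

end

section \<open>The trace form and Cartan's criterion\<close>

context finite_dimensional_leibniz_algebra
begin

abbreviation coords :: "'a \<Rightarrow> 'a \<Rightarrow> 'k" where
  "coords \<equiv> representation Basis"

lemma coords_simps: "coords (x + y) i = coords x i + coords y i" "coords (x - y) i = coords x i - coords y i"
  "coords (scale c x) i = c * coords x i" "coords 0 i = 0"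
  by (simp_all add: representation_add[OF independent_Basis] representation_diff[OF independent_Basis]
      representation_scale[OF independent_Basis] representation_zero span_Basis)

lemma coords_outside: "i \<notin> Basis \<Longrightarrow> coords x i = 0"
  using representation_ne_zero by blast

lemma coords_expand: "(\<Sum>i\<in>Basis. scale (coords x i) i) = x"
  by (intro sum_representation_eq independent_Basis finite_Basis order_refl) (simp add: span_Basis)

text \<open>The matrix of the right multiplication by \<open>a\<close>.\<close>
definition rmat :: "'a \<Rightarrow> 'a \<Rightarrow> 'a \<Rightarrow> 'k" where
  "rmat a = (\<lambda>i j. coords (br j a) i)"

lemma coords_br: "coords (br y a) i = (\<Sum>k\<in>Basis. rmat a i k * coords y k)"
proof -
  have "coords (br (\<Sum>k\<in>S. scale (f k) k) a) i = (\<Sum>k\<in>S. rmat a i k * f k)" for S f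
    by (induction S rule: infinite_finite_induct)
      (simp_all add: br_zero_left br_add_left br_scale_left coords_simps rmat_def mult.commute)
  from this[of "coords y" Basis] show ?thesis by (simp add: coords_expand)
qed

lemma rmat_add: "rmat (a + b) = rmat a + rmat b"
  and rmat_diff: "rmat (a - b) = rmat a - rmat b"
  and rmat_scale: "rmat (scale c a) = mscale c (rmat a)"
  and rmat_zero: "rmat 0 = 0"
proof -
  show *: "rmat (a + b) = rmat a + rmat b" for a b
    by (simp add: rmat_def fun_eq_iff br_add_right coords_simps)
  show "rmat (a - b) = rmat a - rmat b" using *[of "a - b" b] by simp
qed (simp_all add: rmat_def fun_eq_iff br_scale_right br_zero_right coords_simps mscale_def)

text \<open>The Leibniz identity \<open>R\<^bsub>[a, b]\<^esub> = R\<^sub>b R\<^sub>a - R\<^sub>a R\<^sub>b\<close>: right multiplications represent the opposite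
  of the commutator bracket.\<close>
lemma rmat_br: "rmat (br a b) = commutator Basis (rmat b) (rmat a)"
proof (intro ext)
  fix i j
  have "mprod Basis (rmat b) (rmat a) i j = coords (br (br j a) b) i" for a b
    by (simp add: coords_br[of "br j a" b i] mprod_def rmat_def[of a])
  moreover have "br j (br a b) = br (br j a) b - br (br j b) a"
    using leibniz_identity[of j a b] by simp
  ultimately show "rmat (br a b) i j = commutator Basis (rmat b) (rmat a) i j"
    by (simp add: rmat_def[of "br a b"] commutator_def coords_simps)
qed

definition trace_form :: "'a \<Rightarrow> 'a \<Rightarrow> 'k" where
  "trace_form a b = mtrace Basis (mprod Basis (rmat a) (rmat b))"

lemma trace_form_linear:
  "trace_form (a + a') b = trace_form a b + trace_form a' b"
  "trace_form (a - a') b = trace_form a b - trace_form a' b"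
  "trace_form (scale c a) b = c * trace_form a b"
  "trace_form 0 b = 0"
  by (simp_all add: trace_form_def rmat_add rmat_diff rmat_scale rmat_zero mprod_add mprod_diff mprod_mscale)

lemma trace_form_commute: "trace_form a b = trace_form b a"
  unfolding trace_form_def by (rule mtrace_commute)

lemma trace_form_linear_right:
  "trace_form b (a + a') = trace_form b a + trace_form b a'"
  "trace_form b (a - a') = trace_form b a - trace_form b a'"
  "trace_form b (scale c a) = c * trace_form b a"
  "trace_form b 0 = 0"
  by (simp_all add: trace_form_linear trace_form_commute[of b])

lemma trace_form_invariant: "trace_form (br x z) y = trace_form x (br z y)"
proof -
  have "trace_form x (br z y) = mtrace Basis (mprod Basis (commutator Basis (rmat x) (rmat y)) (rmat z))"
    by (simp add: trace_form_def rmat_br mtrace_commutator)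
  also have "\<dots> = mtrace Basis (mprod Basis (rmat z) (commutator Basis (rmat x) (rmat y)))"
    by (rule mtrace_commute)
  also have "\<dots> = mtrace Basis (mprod Basis (commutator Basis (rmat z) (rmat x)) (rmat y))"
    by (rule mtrace_commutator)
  also have "\<dots> = trace_form (br x z) y" by (simp add: trace_form_def rmat_br)
  finally show ?thesis by simp
qed

end

lemma to_ac_matrix:
  "mprod K (\<lambda>i k. to_ac (M i k)) (\<lambda>k j. to_ac (N k j)) = (\<lambda>i j. to_ac (mprod K M N i j))"
  "mtrace K (\<lambda>i j. to_ac (L i j)) = to_ac (mtrace K L)"
  "commutator K (\<lambda>i j. to_ac (A i j)) (\<lambda>i j. to_ac (B i j)) = (\<lambda>i j. to_ac (commutator K A B i j))"
  by (simp_all add: mprod_def mtrace_def commutator_def to_ac_sum fun_eq_iff)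

locale finite_dimensional_leibniz_algebra_char_0 = finite_dimensional_leibniz_algebra scale br Basis
  for scale :: "'k::field_char_0 \<Rightarrow> 'a::ab_group_add \<Rightarrow> 'a" and br and Basis
begin

text \<open>Apply \<open>nilpotent_if_trace_zero\<close> to the space \<open>W\<close> of the matrices over the algebraic closure that are
  orthogonal to all \<open>R\<^sub>a\<close>, \<open>a \<in> A\<close>, under the trace. If \<open>[D, W] \<subseteq> W\<close>, then
  \<open>tr (R\<^bsub>[a, b]\<^esub> D) = tr ([R\<^sub>b, R\<^sub>a] D) = tr (R\<^sub>a [D, R\<^sub>b]) = 0\<close>, because \<open>R\<^sub>b \<in> W\<close>.\<close>
theorem cartan_right_nilpotent:
  assumes A: "subspace A" "\<And>a b. a \<in> A \<Longrightarrow> b \<in> A \<Longrightarrow> br a b \<in> A"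
    and form: "\<And>a b. a \<in> A \<Longrightarrow> b \<in> A \<Longrightarrow> trace_form a b = 0"
    and x: "x \<in> span {br a b |a b. a \<in> A \<and> b \<in> A}"
  shows "\<exists>m. \<forall>y. ((\<lambda>y. br y x) ^^ m) y = 0"
proof -
  define \<rho> :: "'a \<Rightarrow> 'a \<Rightarrow> 'a \<Rightarrow> 'k alg_closure" where "\<rho> = (\<lambda>a i j. to_ac (rmat a i j))"
  have \<rho>_lin: "\<rho> (a + b) = \<rho> a + \<rho> b" "\<rho> (scale c a) = mscale (to_ac c) (\<rho> a)" "\<rho> 0 = 0" for a b c
    by (simp_all add: \<rho>_def rmat_add rmat_scale rmat_zero mscale_def fun_eq_iff)
  have \<rho>_br: "\<rho> (br a b) = commutator Basis (\<rho> b) (\<rho> a)" for a b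
    by (simp add: \<rho>_def rmat_br to_ac_matrix)
  have \<rho>_form: "mtrace Basis (mprod Basis (\<rho> a) (\<rho> b)) = to_ac (trace_form a b)" for a b
    by (simp add: \<rho>_def trace_form_def to_ac_matrix)
  define W where "W = {M. \<forall>a\<in>A. mtrace Basis (mprod Basis (\<rho> a) M) = 0}"
  have xA: "x \<in> A"
    using x span_minimal[OF _ A(1), of "{br a b |a b. a \<in> A \<and> b \<in> A}"] A(2) by blast
  have "\<exists>m. \<forall>v. (\<forall>i. i \<notin> Basis \<longrightarrow> v i = 0) \<longrightarrow> (mapply Basis (\<rho> x) ^^ m) v = 0"
  proof (rule nilpotent_if_trace_zero[OF finite_Basis])
    show "matrix_space.subspace W"
      by (rule matrix_space.subspaceI) (simp_all add: W_def mprod_add mprod_mscale)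
  next
    fix M assume M: "M \<in> W"
    have "mtrace Basis (mprod Basis (\<rho> a) (commutator Basis (\<rho> x) M)) = 0" if "a \<in> A" for a
    proof -
      have "mtrace Basis (mprod Basis (\<rho> (br x a)) M) = 0" using M A(2)[OF xA that] by (simp add: W_def)
      then show ?thesis by (simp add: mtrace_commutator \<rho>_br)
    qed
    then show "commutator Basis (\<rho> x) M \<in> W" by (simp add: W_def)
  next
    fix M N :: "'a \<Rightarrow> 'a \<Rightarrow> 'k alg_closure"
    assume M: "M \<in> W" and eq: "\<And>i j. i \<in> Basis \<Longrightarrow> j \<in> Basis \<Longrightarrow> M i j = N i j"
    have "mtrace Basis (mprod Basis (\<rho> a) M) = mtrace Basis (mprod Basis (\<rho> a) N)" for a
      by (rule mtrace_cong, rule mprod_cong) (simp_all add: eq)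
    then show "N \<in> W" using M by (simp add: W_def)
  next
    fix D :: "'a \<Rightarrow> 'a \<Rightarrow> 'k alg_closure"
    assume D: "\<And>M. M \<in> W \<Longrightarrow> commutator Basis D M \<in> W"
    show "mtrace Basis (mprod Basis (\<rho> x) D) = 0"
      using x
    proof (induction rule: span_induct_alt)
      case (step c s t)
      then obtain a b where ab: "s = br a b" "a \<in> A" "b \<in> A" by blast
      have "\<rho> b \<in> W" using ab form by (simp add: W_def \<rho>_form)
      then have "mtrace Basis (mprod Basis (\<rho> a) (commutator Basis D (\<rho> b))) = 0"
        using D ab by (simp add: W_def)
      then have "mtrace Basis (mprod Basis (commutator Basis D (\<rho> b)) (\<rho> a)) = 0"
        using mtrace_commute by metis
      then have "mtrace Basis (mprod Basis D (\<rho> s)) = 0"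
        by (simp add: mtrace_commutator ab(1) \<rho>_br)
      then have "mtrace Basis (mprod Basis (\<rho> s) D) = 0"
        using mtrace_commute by metis
      then show ?case
        using step.IH by (simp only: \<rho>_lin mprod_add mprod_mscale mtrace_simps mult_zero_right add_0)
    qed (simp only: \<rho>_lin mprod_zero mtrace_simps)
  qed
  then obtain m where m: "\<And>v. (\<forall>i. i \<notin> Basis \<longrightarrow> v i = 0) \<Longrightarrow> (mapply Basis (\<rho> x) ^^ m) v = 0" by blast
  have mapply_coords: "mapply Basis (\<rho> x) (\<lambda>i. to_ac (coords y i)) = (\<lambda>i. to_ac (coords (br y x) i))" for y
    by (auto simp: mapply_def \<rho>_def fun_eq_iff coords_outside) (simp add: coords_br to_ac_sum)
  have pow: "(mapply Basis (\<rho> x) ^^ k) (\<lambda>i. to_ac (coords y i)) =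
      (\<lambda>i. to_ac (coords (((\<lambda>y. br y x) ^^ k) y) i))" for k y
    by (induction k) (simp_all add: mapply_coords)
  have "((\<lambda>y. br y x) ^^ m) y = 0" for y
  proof -
    have "(\<lambda>i. to_ac (coords (((\<lambda>y. br y x) ^^ m) y) i)) = 0"
      unfolding pow[symmetric] by (rule m) (simp add: coords_outside)
    then have "coords (((\<lambda>y. br y x) ^^ m) y) i = 0" for i by (simp add: fun_eq_iff)
    then show ?thesis using coords_expand[of "((\<lambda>y. br y x) ^^ m) y"] by simp
  qed
  then show ?thesis by blast
qed

text \<open>From its second term on, the derived series of \<open>A\<close> consists of subalgebras whose right multiplications
  are nilpotent, so it decreases strictly as long as it is not zero.\<close>
theorem cartan_solvable:
  assumes A: "subspace A" "\<And>a b. a \<in> A \<Longrightarrow> b \<in> A \<Longrightarrow> br a b \<in> A"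
    and form: "\<And>a b. a \<in> A \<Longrightarrow> b \<in> A \<Longrightarrow> trace_form a b = 0"
  shows "leibniz_solvable scale br A"
proof (rule ccontr)
  let ?D = "derived_series scale br A"
  assume "\<not> ?thesis"
  then have ne: "?D m \<noteq> {0}" for m by (auto simp: leibniz_solvable_def)
  have sub: "subspace (?D m)" for m by (rule subspace_derived_series[OF A(1)])
  have prod: "br x y \<in> ?D (Suc m)" if "x \<in> ?D m" "y \<in> ?D m" for x y m
    using that by (auto intro: span_base)
  have dec: "?D (Suc m) \<subseteq> ?D m" for m
  proof (induction m)
    case 0
    have "span {br x y |x y. x \<in> A \<and> y \<in> A} \<subseteq> A" using A by (intro span_minimal) auto
    then show ?case by simp
  next
    case (Suc m)
    have "{br x y |x y. x \<in> ?D (Suc m) \<and> y \<in> ?D (Suc m)} \<subseteq> ?D (Suc m)"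
      using prod Suc.IH by blast
    then have "span {br x y |x y. x \<in> ?D (Suc m) \<and> y \<in> ?D (Suc m)} \<subseteq> ?D (Suc m)"
      by (rule span_minimal[OF _ sub])
    then show ?case by (subst derived_series.simps(2))
  qed
  have dec1: "?D (Suc m) \<subseteq> ?D 1" for m
    by (induction m) (use dec in \<open>auto simp del: derived_series.simps\<close>)
  have "?D (Suc (Suc m)) \<subset> ?D (Suc m)" for m
  proof -
    have nil: "\<exists>k. \<forall>y. ((\<lambda>y. br y x) ^^ k) y = 0" if "x \<in> ?D (Suc m)" for x
      using cartan_right_nilpotent[OF A form, of x] dec1[of m] that by auto
    show ?thesis
      unfolding derived_series.simps(2)[of _ _ _ "Suc m"]
    proof (rule right_nilpotent_not_perfect[OF sub _ ne nil])
      show "br x y \<in> ?D (Suc m)" if "x \<in> ?D (Suc m)" "y \<in> ?D (Suc m)" for x y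
        using prod[OF that] dec by blast
    qed
  qed
  then have lt: "dim (?D (Suc (Suc m))) < dim (?D (Suc m))" for m
    by (intro dim_psubset) (metis sub span_eq_iff)
  have "dim (?D (Suc m)) + m \<le> dim (?D 1)" for m
  proof (induction m)
    case (Suc m)
    then show ?case using lt[of m] by linarith
  qed simp
  from this[of "Suc (dim (?D 1))"] show False by simp
qed

text \<open>Orthogonal projection onto \<open>D\<close> exists for every \<open>x\<close> that is orthogonal to the radical of the form on \<open>D\<close>.
  Choose a subspace \<open>E \<subseteq> D\<close> of greatest dimension onto which all vectors can be projected. A vector of
  \<open>F = D \<inter> E\<^sup>\<bottom>\<close> with \<open>trace_form u u \<noteq> 0\<close> could be added to \<open>E\<close>, so by polarisation the form vanishes on
  \<open>F\<close>. As \<open>D = E + F\<close>, the projection onto \<open>E\<close> already works for \<open>D\<close>.\<close>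
theorem trace_form_projection:
  assumes D: "subspace D" and x: "\<And>z. z \<in> D \<Longrightarrow> (\<And>d. d \<in> D \<Longrightarrow> trace_form z d = 0) \<Longrightarrow> trace_form x z = 0"
  shows "\<exists>d\<in>D. \<forall>d'\<in>D. trace_form (x - d) d' = 0"
proof -
  let ?P = "\<lambda>E. subspace E \<and> E \<subseteq> D \<and> (\<forall>x. \<exists>e\<in>E. \<forall>d\<in>E. trace_form (x - e) d = 0)"
  have "?P {0}" using subspace_0[OF D] by (simp add: trace_form_linear_right)
  moreover have "\<forall>U. ?P U \<longrightarrow> dim U < Suc (dim UNIV)"
    using dim_subset[OF subset_UNIV] by (simp add: less_Suc_eq_le)
  ultimately have "\<exists>U. ?P U \<and> (\<forall>U'. ?P U' \<longrightarrow> dim U' \<le> dim U)"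
    by (rule Lattices_Big.ex_has_greatest_nat)
  then obtain E where E: "?P E" and max: "\<And>U'. ?P U' \<Longrightarrow> dim U' \<le> dim E" by blast
  have subE: "subspace E" using E by blast
  define F where "F = {f \<in> D. \<forall>e\<in>E. trace_form f e = 0}"
  have FF: "trace_form u u = 0" if u: "u \<in> F" for u
  proof (rule ccontr)
    assume ne: "trace_form u u \<noteq> 0"
    let ?E = "span (insert u E)"
    have "\<exists>e\<in>?E. \<forall>d\<in>?E. trace_form (y - e) d = 0" for y
    proof -
      obtain e where e: "e \<in> E" "\<forall>d\<in>E. trace_form (y - e) d = 0" using E by blast
      \<comment> \<open>one step of Gram-Schmidt orthogonalisation\<close>
      define c where "c = trace_form (y - e) u / trace_form u u"
      have ort: "trace_form (y - (e + scale c u)) d = 0" if "d \<in> insert u E" for d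
      proof -
        have "trace_form (y - (e + scale c u)) d = trace_form (y - e) d - c * trace_form u d"
          by (simp add: trace_form_linear algebra_simps)
        moreover have "d \<in> E \<Longrightarrow> trace_form (y - e) d = 0" "d \<in> E \<Longrightarrow> trace_form u d = 0"
          using e(2) u by (simp_all add: F_def)
        moreover have "trace_form (y - e) u - c * trace_form u u = 0" using ne by (simp add: c_def)
        ultimately show ?thesis using that by auto
      qed
      have "trace_form (y - (e + scale c u)) d = 0" if "d \<in> ?E" for d
        using that by (induction rule: span_induct_alt) (auto simp: trace_form_linear_right ort)
      moreover have "e + scale c u \<in> ?E" using e(1) by (auto intro!: span_add span_scale intro: span_base)
      ultimately show ?thesis by blast
    qed
    moreover have "?E \<subseteq> D" using E u by (intro span_minimal D) (auto simp: F_def)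
    ultimately have "?P ?E" by simp
    then have "dim ?E \<le> dim E" by (rule max)
    moreover have "E \<subseteq> ?E" by (auto intro: span_base)
    ultimately have "E = ?E" by (intro subspace_dim_equal subE subspace_span)
    then have "u \<in> E" using span_base[of u "insert u E"] by simp
    then show False using ne u by (simp add: F_def)
  qed
  have subF: "subspace F"
    using subspace_0[OF D] subspace_add[OF D] subspace_scale[OF D]
    by (intro subspaceI) (auto simp: F_def trace_form_linear)
  have FF': "trace_form u v = 0" if "u \<in> F" "v \<in> F" for u v
  proof -
    have "trace_form (u + v) (u + v) = 0" using FF subspace_add[OF subF that] .
    then have "2 * trace_form u v = 0"
      using FF that by (simp add: trace_form_linear trace_form_linear_right trace_form_commute[of v u])
    then show ?thesis by simp
  qed
  have split: "\<exists>e\<in>E. d - e \<in> F" if "d \<in> D" for d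
  proof -
    obtain e where e: "e \<in> E" "\<forall>e'\<in>E. trace_form (d - e) e' = 0" using E by blast
    moreover have "d - e \<in> D" using that e(1) E subspace_diff[OF D] by blast
    ultimately show ?thesis by (auto simp: F_def)
  qed
  have F_perp: "trace_form f d = 0" if f: "f \<in> F" and d: "d \<in> D" for f d
  proof -
    obtain e where e: "e \<in> E" "d - e \<in> F" by (rule bexE[OF split[OF d]])
    have "trace_form f e = 0" using f e(1) by (simp add: F_def)
    moreover have "trace_form f (d - e) = 0" by (rule FF'[OF f e(2)])
    ultimately show ?thesis by (simp add: trace_form_linear_right)
  qed
  obtain e where e: "e \<in> E" "\<forall>d\<in>E. trace_form (x - e) d = 0" using E by blast
  have "trace_form (x - e) d = 0" if d: "d \<in> D" for d
  proof -
    obtain e' where e': "e' \<in> E" "d - e' \<in> F" by (rule bexE[OF split[OF d]])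
    have "d - e' \<in> D" "trace_form (d - e') e = 0" using e'(2) e(1) by (simp_all add: F_def)
    then have "trace_form x (d - e') = 0" "trace_form e (d - e') = 0"
      using x F_perp[OF e'(2)] by (blast, metis trace_form_commute)
    moreover have "trace_form (x - e) e' = 0" using e(2) e'(1) by blast
    ultimately show ?thesis by (simp add: trace_form_linear trace_form_linear_right)
  qed
  then show ?thesis using e(1) E by blast
qed

end

section \<open>Ideals of the Leibniz n-algebra\<close>

context leibniz_algebra
begin

abbreviation Leib :: "'a set" where
  "Leib \<equiv> leibniz_kernel scale br"

lemma subspace_kernel: "subspace Leib"
  by (simp add: leibniz_kernel_def)

lemma br_kernel_right: "z \<in> Leib \<Longrightarrow> br x z = 0"
  unfolding leibniz_kernel_def
  by (induction rule: span_induct_alt)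
    (auto simp: br_zero_right br_add_right br_scale_right br_square_right)

lemma br_kernel_left: "z \<in> Leib \<Longrightarrow> br z x \<in> Leib"
  using leibniz_kernel_ideal by (rule leibniz_idealD(2))

lemma br_swap_kernel: "br x y + br y x \<in> Leib"
proof -
  have "br x y + br y x = br (x + y) (x + y) - br x x - br y y"
    by (simp add: br_add_left br_add_right)
  also have "\<dots> \<in> Leib"
    unfolding leibniz_kernel_def by (intro span_diff) (auto intro: span_base)
  finally show ?thesis .
qed

text \<open>Modulo \<open>Leib\<close> the product is anticommutative, so above \<open>Leib\<close> right ideals are ideals.\<close>
lemma ideal_if_right_ideal:
  assumes I: "subspace I" "Leib \<subseteq> I" "\<And>x y. x \<in> I \<Longrightarrow> br x y \<in> I"
  shows "leibniz_ideal scale br I"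
proof -
  have "br y x \<in> I" if "x \<in> I" for x y
  proof -
    have "(br x y + br y x) - br x y \<in> I"
      using br_swap_kernel I(2) I(3)[OF that] by (intro subspace_diff[OF I(1)]) auto
    then show ?thesis by simp
  qed
  then show ?thesis using I by (simp add: leibniz_ideal_def)
qed

lemma U_bracket_mem_ideal:
  assumes I: "leibniz_ideal scale br I" and "s < length xs" "xs ! s \<in> I"
  shows "U_bracket br xs \<in> I"
  using assms(2,3)
proof (induction xs arbitrary: s)
  case (Cons a xs)
  show ?case
  proof (cases "xs = []")
    case False
    show ?thesis
    proof (cases s)
      case 0
      then show ?thesis using Cons.prems False leibniz_idealD(2)[OF I] by (simp add: U_bracket_Cons)
    next
      case (Suc t)
      then have "U_bracket br xs \<in> I" using Cons by auto
      then show ?thesis using False leibniz_idealD(3)[OF I] by (simp add: U_bracket_Cons)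
    qed
  qed (use Cons.prems in simp)
qed simp

lemma leibniz_ideal_imp_n_ideal:
  assumes "leibniz_ideal scale br I"
  shows "leibniz_n_ideal scale n (U_bracket br) I"
  unfolding leibniz_n_ideal_def
  using leibniz_idealD(1)[OF assms] U_bracket_mem_ideal[OF assms] by auto

lemma br_span_kernel_right:
  assumes "y \<in> span (S \<union> Leib)" "subspace T" "\<And>s. s \<in> S \<Longrightarrow> br x s \<in> T"
  shows "br x y \<in> T"
  using assms(1)
proof (induction rule: span_induct_alt)
  case base
  show ?case by (simp add: br_zero_right subspace_0[OF assms(2)])
next
  case (step c s t)
  then have "br x s \<in> T"
    using assms(3) subspace_0[OF assms(2)] by (auto simp: br_kernel_right)
  then show ?case
    using step.IH
    by (simp add: br_add_right br_scale_right subspace_add[OF assms(2)] subspace_scale[OF assms(2)])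
qed

lemma span_kernel_subset:
  assumes "S \<subseteq> span (T \<union> Leib)"
  shows "span (S \<union> Leib) \<subseteq> span (T \<union> Leib)"
  using assms by (intro span_minimal) (auto intro: span_base)

text \<open>If \<open>L = [L, L] + Leib\<close>, then \<open>L\<close> is spanned modulo \<open>Leib\<close> by nested brackets of any length: replace the
  right factor of \<open>[x, y]\<close> by shorter nested brackets, which is possible because \<open>[x, Leib] = 0\<close>.\<close>
lemma U_brackets_span:
  assumes perfect: "UNIV \<subseteq> span ({br x y |x y. True} \<union> Leib)"
  shows "UNIV \<subseteq> span ({U_bracket br ys |ys. length ys = Suc m} \<union> Leib)"
proof (induction m)
  case 0
  have "x \<in> {U_bracket br ys |ys. length ys = Suc 0}" for x
    by (rule CollectI, rule exI[of _ "[x]"]) simp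
  then show ?case using span_base by blast
next
  case (Suc m)
  let ?T = "{U_bracket br ys |ys. length ys = Suc (Suc m)}"
  have "br x y \<in> span (?T \<union> Leib)" for x y
  proof (rule br_span_kernel_right)
    show "y \<in> span ({U_bracket br ys |ys. length ys = Suc m} \<union> Leib)" using Suc by blast
    fix s assume "s \<in> {U_bracket br ys |ys. length ys = Suc m}"
    then obtain ys where "s = U_bracket br ys" "length ys = Suc m" by blast
    then have "br x s = U_bracket br (x # ys)" "length (x # ys) = Suc (Suc m)"
      by (auto simp: U_bracket_Cons[of ys] simp flip: length_0_conv)
    then have "br x s \<in> ?T" by blast
    then show "br x s \<in> span (?T \<union> Leib)" by (intro span_base) blast
  qed simp
  then have "span ({br x y |x y. True} \<union> Leib) \<subseteq> span (?T \<union> Leib)"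
    by (intro span_kernel_subset) blast
  then show ?case using perfect by blast
qed

text \<open>The hypothesis \<open>prods\<close> is used for \<open>J = L\<close>, to write the right factor of a product as nested brackets,
  and for \<open>J = I + Leib\<close>, to write elements of \<open>I\<close> modulo \<open>Leib\<close> as nested brackets that start in \<open>I\<close>.\<close>
theorem n_ideal_imp_leibniz_ideal:
  assumes n: "2 \<le> n" and I: "leibniz_n_ideal scale n (U_bracket br) I"
    and prods: "\<And>J. leibniz_ideal scale br J \<Longrightarrow> Leib \<subseteq> J \<Longrightarrow>
      J \<subseteq> span ({br x y |x y. x \<in> J} \<union> Leib)"
  shows "leibniz_ideal scale br I"
proof -
  have subI: "subspace I" using I by (simp add: leibniz_n_ideal_def)
  have mem: "U_bracket br xs \<in> I" if "length xs = n" "s < n" "xs ! s \<in> I" for xs s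
    using I that by (auto simp: leibniz_n_ideal_def)
  have "leibniz_ideal scale br UNIV" by (simp add: leibniz_ideal_def)
  then have "UNIV \<subseteq> span ({br x y |x y. True} \<union> Leib)" using prods[of UNIV] by simp
  note gen = U_brackets_span[OF this]
  \<comment> \<open>\<open>n - 1\<close> nested factors on the right of \<open>x\<close>: the first position of an \<open>n\<close>-fold bracket\<close>
  have right: "br x y \<in> I" if x: "x \<in> I" for x y
  proof (rule br_span_kernel_right[OF _ subI])
    show "y \<in> span ({U_bracket br ys |ys. length ys = Suc (n - 2)} \<union> Leib)" using gen by blast
    fix s assume "s \<in> {U_bracket br ys |ys. length ys = Suc (n - 2)}"
    then obtain ys where ys: "s = U_bracket br ys" "length ys = Suc (n - 2)" by blast
    then have "br x s = U_bracket br (x # ys)"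
      by (auto simp: U_bracket_Cons[of ys] simp flip: length_0_conv)
    moreover have "U_bracket br (x # ys) \<in> I" using ys n x by (intro mem[of _ 0]) auto
    ultimately show "br x s \<in> I" by simp
  qed
  let ?J = "span (I \<union> Leib)"
  have J_right: "br x y \<in> span ({br x y |x y. x \<in> I} \<union> Leib)" if "x \<in> ?J" for x y
    using that
  proof (induction rule: span_induct_alt)
    case (step c s t)
    then have "br s y \<in> span ({br x y |x y. x \<in> I} \<union> Leib)"
      using br_kernel_left by (auto intro: span_base)
    then show ?case using step by (simp add: br_add_left br_scale_left span_add span_scale)
  qed (simp add: br_zero_left span_zero)
  have "{br x y |x y. x \<in> I} \<subseteq> ?J" using right by (auto intro: span_base)
  then have "br x y \<in> ?J" if "x \<in> ?J" for x y using J_right[OF that] span_kernel_subset by blast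
  then have J_ideal: "leibniz_ideal scale br ?J"
    by (intro ideal_if_right_ideal subspace_span) (auto intro: span_base)
  have I_prods: "I \<subseteq> span ({br x y |x y. x \<in> I} \<union> Leib)"
  proof -
    have "?J \<subseteq> span ({br x y |x y. x \<in> ?J} \<union> Leib)"
      by (rule prods[OF J_ideal]) (auto intro: span_base)
    also have "\<dots> \<subseteq> span ({br x y |x y. x \<in> I} \<union> Leib)"
      using J_right by (intro span_kernel_subset) blast
    finally show ?thesis using span_superset[of "I \<union> Leib"] by blast
  qed
  have I_gen: "I \<subseteq> span ({U_bracket br (i # ys) |i ys. i \<in> I \<and> length ys = m} \<union> Leib)" for m
  proof (cases m)
    case 0
    have "i \<in> {U_bracket br (i # ys) |i ys. i \<in> I \<and> length ys = m}" if "i \<in> I" for i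
      using that 0 by (intro CollectI exI[of _ i] exI[of _ "[]"]) simp
    then show ?thesis using span_base by blast
  next
    case (Suc k)
    let ?T = "{U_bracket br (i # ys) |i ys. i \<in> I \<and> length ys = m}"
    have "br x y \<in> span (?T \<union> Leib)" if x: "x \<in> I" for x y
    proof (rule br_span_kernel_right)
      show "y \<in> span ({U_bracket br ys |ys. length ys = Suc k} \<union> Leib)" using gen by blast
      fix s assume "s \<in> {U_bracket br ys |ys. length ys = Suc k}"
      then obtain ys where ys: "s = U_bracket br ys" "length ys = Suc k" by blast
      then have "br x s = U_bracket br (x # ys)"
        by (auto simp: U_bracket_Cons[of ys] simp flip: length_0_conv)
      then have "br x s \<in> ?T" using ys x Suc by blast
      then show "br x s \<in> span (?T \<union> Leib)" by (intro span_base) blast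
    qed simp
    then have "span ({br x y |x y. x \<in> I} \<union> Leib) \<subseteq> span (?T \<union> Leib)"
      by (intro span_kernel_subset) blast
    then show ?thesis using I_prods by blast
  qed
  \<comment> \<open>\<open>i\<close> follows \<open>y\<close>: the second position of an \<open>n\<close>-fold bracket\<close>
  have "br y x \<in> I" if x: "x \<in> I" for x y
  proof (rule br_span_kernel_right[OF _ subI])
    show "x \<in> span ({U_bracket br (i # ys) |i ys. i \<in> I \<and> length ys = n - 2} \<union> Leib)"
      using I_gen x by blast
    fix s assume "s \<in> {U_bracket br (i # ys) |i ys. i \<in> I \<and> length ys = n - 2}"
    then obtain i ys where ys: "s = U_bracket br (i # ys)" "i \<in> I" "length ys = n - 2" by blast
    have "U_bracket br (y # i # ys) \<in> I" using ys n by (intro mem[of _ 1]) auto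
    then show "br y s \<in> I" by (simp add: ys)
  qed
  then show ?thesis using right subI by (simp add: leibniz_ideal_def)
qed

end

context finite_dimensional_leibniz_algebra_char_0
begin

definition perp :: "'a set \<Rightarrow> 'a set" where
  "perp D = {x. \<forall>d\<in>D. trace_form x d = 0}"

text \<open>Elements of \<open>Leib\<close> act by zero from the right.\<close>
lemma trace_form_kernel: "z \<in> Leib \<Longrightarrow> trace_form z d = 0"
proof -
  assume "z \<in> Leib"
  then have "rmat z = 0" by (simp add: rmat_def br_kernel_right coords_simps fun_eq_iff)
  then show ?thesis by (simp add: trace_form_def)
qed

lemma perp_ideal:
  assumes "leibniz_ideal scale br D"
  shows "leibniz_ideal scale br (perp D)"
proof (rule ideal_if_right_ideal)
  show "subspace (perp D)" by (rule subspaceI) (auto simp: perp_def trace_form_linear)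
  show "Leib \<subseteq> perp D" using trace_form_kernel by (auto simp: perp_def)
  show "br x y \<in> perp D" if "x \<in> perp D" for x y
    using that leibniz_idealD(3)[OF assms] by (auto simp: perp_def trace_form_invariant)
qed

lemma ideal_inter:
  assumes "leibniz_ideal scale br I" "leibniz_ideal scale br J"
  shows "leibniz_ideal scale br (I \<inter> J)"
  using assms by (auto simp: leibniz_ideal_def subspace_inter)

text \<open>With \<open>D\<close> the span on the right, \<open>A = D \<inter> D\<^sup>\<bottom>\<close> is solvable by Cartan's criterion, so \<open>A \<subseteq> Leib\<close> by
  semisimplicity. This allows the orthogonal projection of \<open>J\<close> to \<open>D\<close>, whose kernel \<open>C = J \<inter> D\<^sup>\<bottom>\<close> has
  \<open>[C, C] \<subseteq> A \<subseteq> Leib\<close> and \<open>[Leib, Leib] = 0\<close>; so \<open>C\<close> is solvable and contained in \<open>Leib\<close>, too.\<close>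
theorem ideal_generated_by_products:
  assumes ss: "leibniz_semisimple scale br"
    and J: "leibniz_ideal scale br J" "Leib \<subseteq> J"
  shows "J \<subseteq> span ({br x y |x y. x \<in> J} \<union> Leib)"
proof
  fix x assume x: "x \<in> J"
  let ?D = "span ({br x y |x y. x \<in> J} \<union> Leib)"
  note subJ = leibniz_idealD(1)[OF J(1)]
  have solvable: "K \<subseteq> Leib" if "leibniz_ideal scale br K" "leibniz_solvable scale br K" for K
    using leibniz_rad_greatest(3)[OF finite_dimensional_vector_space_axioms that] ss
    by (simp add: leibniz_semisimple_def)
  have D_J: "?D \<subseteq> J"
    using J leibniz_idealD(2)[OF J(1)] by (intro span_minimal subJ) auto
  have D_prod: "br j y \<in> ?D" if "j \<in> J" for j y using that by (intro span_base) blast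
  have D: "leibniz_ideal scale br ?D"
    by (rule ideal_if_right_ideal) (use D_J D_prod in \<open>auto intro: span_base\<close>)
  let ?A = "?D \<inter> perp ?D"
  have A: "leibniz_ideal scale br ?A" by (intro ideal_inter perp_ideal D)
  have "leibniz_solvable scale br ?A"
  proof (rule cartan_solvable)
    show "br a b \<in> ?A" if "a \<in> ?A" for a b using leibniz_idealD(2)[OF A that] .
  qed (use leibniz_idealD(1)[OF A] in \<open>auto simp: perp_def\<close>)
  with A have A_ker: "?A \<subseteq> Leib" by (rule solvable)
  have "\<exists>d\<in>?D. \<forall>d'\<in>?D. trace_form (x - d) d' = 0"
  proof (rule trace_form_projection[OF subspace_span])
    fix z assume "z \<in> ?D" "\<And>d. d \<in> ?D \<Longrightarrow> trace_form z d = 0"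
    then have "z \<in> Leib" using A_ker by (auto simp: perp_def)
    then show "trace_form x z = 0" by (simp add: trace_form_commute[of x] trace_form_kernel)
  qed
  then obtain d where d: "d \<in> ?D" "x - d \<in> perp ?D" by (auto simp: perp_def)
  let ?C = "J \<inter> perp ?D"
  have C: "leibniz_ideal scale br ?C" by (intro ideal_inter perp_ideal D J)
  have "leibniz_solvable scale br ?C"
    unfolding leibniz_solvable_def
  proof
    have "br a b \<in> ?A" if "a \<in> ?C" for a b
      using leibniz_idealD(2)[OF C that] D_prod that by blast
    then have "{br x y |x y. x \<in> ?C \<and> y \<in> ?C} \<subseteq> Leib" using A_ker by blast
    from span_minimal[OF this subspace_kernel] have "derived_series scale br ?C 1 \<subseteq> Leib" by simp
    then have "br a b = 0" if "b \<in> derived_series scale br ?C 1" for a b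
      using that br_kernel_right by blast
    then have "{br x y |x y. x \<in> derived_series scale br ?C 1 \<and> y \<in> derived_series scale br ?C 1} \<subseteq> {0}"
      by blast
    from span_mono[OF this] have "derived_series scale br ?C 2 \<subseteq> {0}"
      by (simp add: numeral_2_eq_2)
    moreover have "0 \<in> derived_series scale br ?C 2"
      by (intro subspace_0 subspace_derived_series leibniz_idealD(1)[OF C])
    ultimately show "derived_series scale br ?C 2 = {0}" by blast
  qed
  with C have "?C \<subseteq> Leib" by (rule solvable)
  moreover have "x - d \<in> ?C" using d x D_J subspace_diff[OF subJ] by blast
  ultimately have "x - d \<in> ?D" by (auto intro: span_base)
  then have "(x - d) + d \<in> ?D" using d(1) by (rule span_add)
  then show "x \<in> ?D" by simp
qed

end

theorem theorem3p10:
  fixes scale :: "'k::field_char_0 \<Rightarrow> 'a::ab_group_add \<Rightarrow> 'a"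
    and br :: "'a \<Rightarrow> 'a \<Rightarrow> 'a"
    and Basis :: "'a set"
    and n :: nat
  assumes "2 \<le> n"
    and "leibniz_algebra scale br"
    and "finite_dimensional_vector_space scale Basis"
    and "leibniz_semisimple scale br"
  shows "{I. leibniz_n_ideal scale n (U_bracket br) I} = {I. leibniz_ideal scale br I}"
proof -
  interpret leibniz_algebra scale br by (rule assms(2))
  interpret finite_dimensional_vector_space scale Basis by (rule assms(3))
  interpret finite_dimensional_leibniz_algebra_char_0 scale br Basis by unfold_locales
  have "leibniz_ideal scale br I" if "leibniz_n_ideal scale n (U_bracket br) I" for I
    using assms(1) that ideal_generated_by_products[OF assms(4)] by (rule n_ideal_imp_leibniz_ideal)
  then show ?thesis using leibniz_ideal_imp_n_ideal by blast
qed

end
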